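(* Let $(Y,y_0)$ be a based topological space, let $\{(Y,y_0),(Y,y_0)\}$ be the associated self-interactive based $2$-interaction space, and let $\omega_0:S^1\to\{y_0\}$ be the constant loop, i.e. the base point of $\Omega Y$. Then there is an isomorphism $$\pi_0(\Omega\{(Y,y_0),(Y,y_0)\})\cong\pi_0(F(\Omega Y-\omega_0,2)).$$
   Context: An $n$-interaction space $(X,\{X_i\}_{1\le i\le n})$ is a topological space $X$ with a covering $\{X_i\}_{1\le i\le n}$. A morphism $f=\{f_i\}:(X,\{X_i\})\to(Y,\{Y_i\})$ is a family of continuous maps $f_i:X_i\to Y_i$ such that for any $1\le i,j\le n$ and $x_i\in X_i$, $x_j\in X_j$: $f_i(x_i)=f_j(x_j)$ if and only if $x_i=x_j$. With $I=[0,1]$, $f\simeq g$ (formal homotopic) if there is a morphism $H=\{H_i\}:(X\times I,\{X_i\times I\})\to(Y,\{Y_i\})$ with $H_i(x,0)=f_i(x)$, $H_i(x,1)=g_i(x)$; $f\sim g$ (homotopic) if they are connected by a finite chain of formal homotopies. A based interaction space $\{(X_i,x_i)\}_{1\le i\le n}$ is an interaction space with a base point $x_i\in X_i$ for each $i$. In the based setting morphisms and homotopies preserve base points; in the cylinder $\{(X_i\times I,* )\}$ each line $\{x_i\}\times I$ is regarded as the single base point, and the base points of the $i$-th and $j$-th cylinders are regarded as equal exactly when $x_i=x_j$. $[\{(X_i,x_i)\},\{(Y_i,y_i)\}]$ denotes the set of homotopy classes of morphisms. The loop space $\Omega\{(X_i,x_i)\}$ is the based interaction space $\{(\Omega X_i,\omega_i)\}$,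 where $\Omega X_i$ is the space of based loops $(S^1,s_0)\to(X_i,x_i)$ and $\omega_i$ is the constant loop at $x_i$; so $\Omega X_i\cap\Omega X_j=\Omega(X_i\cap X_j)$. A based interaction space is self-interactive if all the $(X_i,x_i)$ coincide. $\pi_0(\Omega\{(Y,y_0),(Y,y_0)\})$ denotes $[\{(S^0,x_0),(S^0,x_0)\},\Omega\{(Y,y_0),(Y,y_0)\}]$, where the two $0$-spheres are disjoint $0$-spheres glued together at their common base point $x_0$ (so their non-base points are distinct). $F(\Omega Y-\omega_0,2)=\{(\omega_1,\omega_2)\in\Omega Y\times\Omega Y \mid \omega_0,\omega_1,\omega_2\text{ are all distinct from each other}\}$, with the subspace topology, and $\pi_0$ of it is its set of path components. On both sides the multiplication is the one induced by componentwise concatenation of loops $\mu(\omega,\omega')(t)=\omega(2t)$ for $0\le t\le 1/2$ and $\omega'(2t-1)$ for $1/2\le t\le 1$; an isomorphism is a bijection respecting it. *)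

theory Defs
  imports "HOL-Analysis.Analysis"
begin

section \<open>Interaction spaces\<close>

text \<open>
  The pieces of an \<open>n\<close>-interaction space are indexed by \<open>{1..n}\<close>; the values of
  \<^term>\<open>pc\<close> and \<^term>\<open>bp\<close> elsewhere are irrelevant. Each piece carries the subspace topology.
\<close>

record 'a ispace =
  amb :: "'a topology"
  pc :: "nat \<Rightarrow> 'a set"

record 'a based_ispace = "'a ispace" +
  bp :: "nat \<Rightarrow> 'a"

definition interaction_space :: "nat \<Rightarrow> ('a, 'm) ispace_scheme \<Rightarrow> bool" where
  "interaction_space n S \<longleftrightarrow> (\<Union>i\<in>{1..n}. pc S i) = topspace (amb S)"

definition based_interaction_space :: "nat \<Rightarrow> ('a, 'm) based_ispace_scheme \<Rightarrow> bool" where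
  "based_interaction_space n S \<longleftrightarrow> interaction_space n S \<and> (\<forall>i\<in>{1..n}. bp S i \<in> pc S i)"

definition self_interactive :: "nat \<Rightarrow> ('a, 'm) based_ispace_scheme \<Rightarrow> bool" where
  "self_interactive n S \<longleftrightarrow>
     (\<forall>i\<in>{1..n}. \<forall>j\<in>{1..n}. pc S i = pc S j \<and> bp S i = bp S j)"

abbreviation piece_top :: "('a, 'm) ispace_scheme \<Rightarrow> nat \<Rightarrow> 'a topology" where
  "piece_top S i \<equiv> subtopology (amb S) (pc S i)"

text \<open>
  Families are taken extensional, so that equality of morphisms is equality on the pieces. The
  case \<open>i = j\<close> of the last condition is intended and makes every component injective.
\<close>

definition ispace_morphisms ::
  "nat \<Rightarrow> ('a, 'm) ispace_scheme \<Rightarrow> ('b, 'k) ispace_scheme \<Rightarrow> (nat \<Rightarrow> 'a \<Rightarrow> 'b) set" where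
  "ispace_morphisms n S T =
     {f \<in> (\<Pi>\<^sub>E i\<in>{1..n}. pc S i \<rightarrow>\<^sub>E pc T i).
        (\<forall>i\<in>{1..n}. continuous_map (piece_top S i) (piece_top T i) (f i)) \<and>
        (\<forall>i\<in>{1..n}. \<forall>j\<in>{1..n}. \<forall>x\<in>pc S i. \<forall>x'\<in>pc S j. f i x = f j x' \<longleftrightarrow> x = x')}"

definition based_morphisms ::
  "nat \<Rightarrow> ('a, 'm) based_ispace_scheme \<Rightarrow> ('b, 'k) based_ispace_scheme
     \<Rightarrow> (nat \<Rightarrow> 'a \<Rightarrow> 'b) set" where
  "based_morphisms n S T = {f \<in> ispace_morphisms n S T. \<forall>i\<in>{1..n}. f i (bp S i) = bp T i}"

text \<open>
  When two points of the cylinders over the \<open>i\<close>-th and the \<open>j\<close>-th piece are regarded as equal: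
  the line over each base point counts as a single point.
\<close>

definition cyl_eq ::
  "('a, 'm) based_ispace_scheme \<Rightarrow> nat \<Rightarrow> 'a \<times> real \<Rightarrow> nat \<Rightarrow> 'a \<times> real \<Rightarrow> bool" where
  "cyl_eq S i p j q \<longleftrightarrow>
     p = q \<or> (fst p = bp S i \<and> fst q = bp S j \<and> bp S i = bp S j)"

text \<open>
  A map on \<open>X\<^sub>i \<times> [0,1]\<close> that is constant on the base line is continuous iff the map it induces on
  the collapsed cylinder is, so homotopies are given on the uncollapsed cylinders.
\<close>

definition based_formal_homotopy ::
  "nat \<Rightarrow> ('a, 'm) based_ispace_scheme \<Rightarrow> ('b, 'k) based_ispace_scheme
     \<Rightarrow> (nat \<Rightarrow> 'a \<times> real \<Rightarrow> 'b) \<Rightarrow> bool" where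
  "based_formal_homotopy n S T H \<longleftrightarrow>
     (\<forall>i\<in>{1..n}.
        continuous_map (prod_topology (piece_top S i) (top_of_set {0..1})) (piece_top T i) (H i) \<and>
        (\<forall>t\<in>{0..1}. H i (bp S i, t) = bp T i)) \<and>
     (\<forall>i\<in>{1..n}. \<forall>j\<in>{1..n}. \<forall>p \<in> pc S i \<times> {0..1}. \<forall>q \<in> pc S j \<times> {0..1}.
        H i p = H j q \<longleftrightarrow> cyl_eq S i p j q)"

definition formally_homotopic ::
  "nat \<Rightarrow> ('a, 'm) based_ispace_scheme \<Rightarrow> ('b, 'k) based_ispace_scheme
     \<Rightarrow> (nat \<Rightarrow> 'a \<Rightarrow> 'b) rel" where
  "formally_homotopic n S T =
     {(f, g) \<in> based_morphisms n S T \<times> based_morphisms n S T.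
        \<exists>H. based_formal_homotopy n S T H \<and>
            (\<forall>i\<in>{1..n}. \<forall>x\<in>pc S i. H i (x, 0) = f i x \<and> H i (x, 1) = g i x)}"

definition homotopic_rel ::
  "nat \<Rightarrow> ('a, 'm) based_ispace_scheme \<Rightarrow> ('b, 'k) based_ispace_scheme
     \<Rightarrow> (nat \<Rightarrow> 'a \<Rightarrow> 'b) rel" where
  "homotopic_rel n S T =
     Restr ((formally_homotopic n S T \<union> (formally_homotopic n S T)\<inverse>)\<^sup>*) (based_morphisms n S T)"

definition homotopy_classes ::
  "nat \<Rightarrow> ('a, 'm) based_ispace_scheme \<Rightarrow> ('b, 'k) based_ispace_scheme
     \<Rightarrow> (nat \<Rightarrow> 'a \<Rightarrow> 'b) set set" where
  "homotopy_classes n S T = based_morphisms n S T // homotopic_rel n S T"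


section \<open>Loops\<close>

definition compact_open_topology :: "'a topology \<Rightarrow> 'b topology \<Rightarrow> ('a \<Rightarrow> 'b) topology" where
  "compact_open_topology X Y =
     topology_generated_by
       {{f \<in> extensional (topspace X). continuous_map X Y f \<and> f ` K \<subseteq> U} |K U.
          compactin X K \<and> openin Y U}"

lemma topspace_compact_open_topology:
  "topspace (compact_open_topology X Y) = {f \<in> extensional (topspace X). continuous_map X Y f}"
proof -
  have "\<exists>K U. {f \<in> extensional (topspace X). continuous_map X Y f} =
      {f \<in> extensional (topspace X). continuous_map X Y f \<and> f ` K \<subseteq> U} \<and>
      compactin X K \<and> openin Y U"
    by (rule exI[of _ "{}"], rule exI[of _ "{}"]) simp
  then show ?thesis
    unfolding compact_open_topology_def topology_generated_by_topspace by blast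
qed

text \<open>
  The based circle is \<open>[0,1]\<close> with its endpoints identified. Since \<open>[0,1] \<rightarrow> S\<^sup>1\<close> is a surjection
  of compact Hausdorff spaces, the compact-open topology on based maps from the circle is the one
  induced from the compact-open topology on maps from \<open>[0,1]\<close>.
\<close>

definition loops :: "'a topology \<Rightarrow> 'a \<Rightarrow> (real \<Rightarrow> 'a) set" where
  "loops X x = {w \<in> extensional {0..1}. pathin X w \<and> w 0 = x \<and> w 1 = x}"

definition const_loop :: "'a \<Rightarrow> real \<Rightarrow> 'a" where
  "const_loop x = (\<lambda>t\<in>{0..1}. x)"

definition loop_topology :: "'a topology \<Rightarrow> 'a \<Rightarrow> (real \<Rightarrow> 'a) topology" where
  "loop_topology X x = subtopology (compact_open_topology (top_of_set {0..1}) X) (loops X x)"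

definition concat_loops :: "(real \<Rightarrow> 'a) \<Rightarrow> (real \<Rightarrow> 'a) \<Rightarrow> real \<Rightarrow> 'a" where
  "concat_loops v w = (\<lambda>t\<in>{0..1}. if t \<le> 1/2 then v (2 * t) else w (2 * t - 1))"

definition loop_ispace :: "nat \<Rightarrow> ('a, 'm) based_ispace_scheme \<Rightarrow> (real \<Rightarrow> 'a) based_ispace" where
  "loop_ispace n S =
     \<lparr>amb = subtopology (compact_open_topology (top_of_set {0..1}) (amb S))
              (\<Union>i\<in>{1..n}. loops (piece_top S i) (bp S i)),
      pc = (\<lambda>i. loops (piece_top S i) (bp S i)),
      bp = (\<lambda>i. const_loop (bp S i))\<rparr>"

lemma loop_ispace_based:
  assumes "based_interaction_space n S"
  shows "based_interaction_space n (loop_ispace n S)"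
proof -
  have sub: "loops (piece_top S i) x \<subseteq> topspace (compact_open_topology (top_of_set {0..1}) (amb S))"
    for i x
  proof
    fix w assume "w \<in> loops (piece_top S i) x"
    then have "w \<in> extensional {0..1}" "continuous_map (top_of_set {0..1}) (amb S) w"
      unfolding loops_def pathin_def mem_Collect_eq
      using continuous_map_into_fulltopology by (blast, blast)
    then show "w \<in> topspace (compact_open_topology (top_of_set {0..1}) (amb S))"
      by (simp add: topspace_compact_open_topology)
  qed
  have const: "const_loop (bp S i) \<in> loops (piece_top S i) (bp S i)" if "i \<in> {1..n}" for i
  proof -
    have "bp S i \<in> topspace (piece_top S i)"
      using assms that unfolding based_interaction_space_def interaction_space_def
        topspace_subtopology by blast
    then have "continuous_map (top_of_set {0..1}) (piece_top S i) (\<lambda>t. bp S i)"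
      by simp
    then have "pathin (piece_top S i) (const_loop (bp S i))"
      unfolding pathin_def const_loop_def by (rule continuous_map_eq) simp
    then show ?thesis by (simp add: loops_def const_loop_def)
  qed
  show ?thesis
    unfolding based_interaction_space_def interaction_space_def
  proof (intro conjI ballI)
    show "(\<Union>i\<in>{1..n}. pc (loop_ispace n S) i) = topspace (amb (loop_ispace n S))"
      using sub by (simp add: loop_ispace_def Int_absorb1 UN_least)
    show "bp (loop_ispace n S) i \<in> pc (loop_ispace n S) i" if "i \<in> {1..n}" for i
      using const[OF that] by (simp add: loop_ispace_def)
  qed
qed


section \<open>The two sides of the isomorphism\<close>

definition self_ispace :: "'a topology \<Rightarrow> 'a \<Rightarrow> 'a based_ispace" where
  "self_ispace Y y0 = \<lparr>amb = Y, pc = (\<lambda>i. topspace Y), bp = (\<lambda>i. y0)\<rparr>"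

lemma self_ispace_props:
  assumes "y0 \<in> topspace Y" "n \<ge> 1"
  shows "based_interaction_space n (self_ispace Y y0)" "self_interactive n (self_ispace Y y0)"
  using assms
  by (auto simp: based_interaction_space_def interaction_space_def self_interactive_def
      self_ispace_def)

text \<open>Two \<open>0\<close>-spheres \<open>{0, 1}\<close> and \<open>{0, 2}\<close> with \<open>0\<close> as common base point.\<close>

definition sphere0_pair :: "nat based_ispace" where
  "sphere0_pair = \<lparr>amb = discrete_topology {0, 1, 2}, pc = (\<lambda>i. {0, i}), bp = (\<lambda>i. 0)\<rparr>"

lemma sphere0_pair_based: "based_interaction_space 2 sphere0_pair"
proof -
  have "{1..2} = {1, 2::nat}" by auto
  then show ?thesis
    by (auto simp: based_interaction_space_def interaction_space_def sphere0_pair_def)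
qed

definition pi0_loop_ispace :: "(real \<Rightarrow> 'a) based_ispace \<Rightarrow> (nat \<Rightarrow> nat \<Rightarrow> real \<Rightarrow> 'a) set set" where
  "pi0_loop_ispace L = homotopy_classes 2 sphere0_pair L"

definition concat_morphisms ::
  "(nat \<Rightarrow> nat \<Rightarrow> real \<Rightarrow> 'a) \<Rightarrow> (nat \<Rightarrow> nat \<Rightarrow> real \<Rightarrow> 'a) \<Rightarrow> nat \<Rightarrow> nat \<Rightarrow> real \<Rightarrow> 'a" where
  "concat_morphisms f g = (\<lambda>i\<in>{1..2}. \<lambda>x\<in>pc sphere0_pair i. concat_loops (f i x) (g i x))"

text \<open>
  As usual for operations induced on a quotient, the product of two classes is the class of the
  product of any representatives, written as a union over all of them.
\<close>

definition pi0_loop_mult ::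
  "(real \<Rightarrow> 'a) based_ispace \<Rightarrow> (nat \<Rightarrow> nat \<Rightarrow> real \<Rightarrow> 'a) set \<Rightarrow> (nat \<Rightarrow> nat \<Rightarrow> real \<Rightarrow> 'a) set
     \<Rightarrow> (nat \<Rightarrow> nat \<Rightarrow> real \<Rightarrow> 'a) set" where
  "pi0_loop_mult L A B =
     (\<Union>f\<in>A. \<Union>g\<in>B. homotopic_rel 2 sphere0_pair L `` {concat_morphisms f g})"

definition loop_config :: "'a topology \<Rightarrow> 'a \<Rightarrow> ((real \<Rightarrow> 'a) \<times> (real \<Rightarrow> 'a)) topology" where
  "loop_config Y y0 =
     subtopology (prod_topology (loop_topology Y y0) (loop_topology Y y0))
       {(w1, w2). distinct [const_loop y0, w1, w2]}"

definition concat_pairs ::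
  "(real \<Rightarrow> 'a) \<times> (real \<Rightarrow> 'a) \<Rightarrow> (real \<Rightarrow> 'a) \<times> (real \<Rightarrow> 'a) \<Rightarrow> (real \<Rightarrow> 'a) \<times> (real \<Rightarrow> 'a)" where
  "concat_pairs v w = (concat_loops (fst v) (fst w), concat_loops (snd v) (snd w))"

definition pi0_config_mult ::
  "'a topology \<Rightarrow> 'a \<Rightarrow> ((real \<Rightarrow> 'a) \<times> (real \<Rightarrow> 'a)) set \<Rightarrow> ((real \<Rightarrow> 'a) \<times> (real \<Rightarrow> 'a)) set
     \<Rightarrow> ((real \<Rightarrow> 'a) \<times> (real \<Rightarrow> 'a)) set" where
  "pi0_config_mult Y y0 A B =
     (\<Union>v\<in>A. \<Union>w\<in>B. path_component_of_set (loop_config Y y0) (concat_pairs v w))"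

text \<open>No unit is part of the structure, so a \<open>monoid\<close> record is not used here.\<close>

definition mult_iso ::
  "'a set \<Rightarrow> ('a \<Rightarrow> 'a \<Rightarrow> 'a) \<Rightarrow> 'b set \<Rightarrow> ('b \<Rightarrow> 'b \<Rightarrow> 'b) \<Rightarrow> ('a \<Rightarrow> 'b) \<Rightarrow> bool" where
  "mult_iso P m Q m' \<phi> \<longleftrightarrow>
     bij_betw \<phi> P Q \<and> (\<forall>a\<in>P. \<forall>b\<in>P. \<phi> (m a b) = m' (\<phi> a) (\<phi> b))"

end

theory Submission
  imports Defs
begin

text \<open>
  A morphism from the two spheres is a point of the configuration space. A formal homotopy
  between two morphisms is more than a path there: injectivity on the cylinders forces the two loops
  to run along disjoint arcs. So the point is that a path in the configuration space can be replaced
  by a chain of moves along disjoint arcs. Concatenation makes this possible, because a concatenation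
  determines both of its factors: while one pair of factors moves along disjoint arcs, the other may
  move along arbitrary paths. Squeezing a loop to the initial part of the interval moves the last time
  at which it is away from the base point, hence is injective in the parameter; with it a pair is moved
  to concatenations with the constant loop. There the constant second factors are replaced
  by fixed distinct nonconstant null-homotopic loops, and moving these along disjoint arcs carries
  along any two homotopies of the first factors. In particular, two configurations are connected as
  soon as their components are homotopic loops.
\<close>

section \<open>Paths of loops\<close>

lemma topspace_loop_topology [simp]: "topspace (loop_topology Y y) = loops Y y"
  by (auto simp: loop_topology_def topspace_compact_open_topology loops_def pathin_def)

text \<open>The compact-open topology is generated by the sets of maps taking a compact
  \<open>K\<close> into an open \<open>U\<close>, so continuity in the parameter is tested on these
  sets. Concatenation and reparametrisation are shown continuous through this criterion.\<close>

lemma pathin_loop_topology_iff: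
  "pathin (loop_topology Y y) h \<longleftrightarrow>
     (\<forall>s\<in>{0..1}. h s \<in> loops Y y) \<and>
     (\<forall>K U. compact K \<and> K \<subseteq> {0..1} \<and> openin Y U \<longrightarrow>
        openin (top_of_set {0..1}) {s\<in>{0..1}. h s ` K \<subseteq> U})" (is "?L \<longleftrightarrow> ?R")
proof -
  have eq: "h -` {f \<in> extensional (topspace (top_of_set {0..1})).
      continuous_map (top_of_set {0..1}) Y f \<and> f ` K \<subseteq> U} \<inter> topspace (top_of_set {0..1::real})
      = {s\<in>{0..1}. h s ` K \<subseteq> U}"
    if "\<forall>s\<in>{0..1}. h s \<in> loops Y y" for K U
    using that by (auto simp: loops_def pathin_def)
  have top: "h ` topspace (top_of_set {0..1}) \<subseteq> topspace (compact_open_topology (top_of_set {0..1}) Y)"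
    if "\<forall>s\<in>{0..1}. h s \<in> loops Y y"
    using that by (auto simp: loops_def pathin_def topspace_compact_open_topology)
  have comp: "compactin (top_of_set {0..1}) K \<longleftrightarrow> compact K \<and> K \<subseteq> {0..1::real}" for K
    by (auto simp: compactin_subtopology)
  have "?L \<longleftrightarrow> (\<forall>s\<in>{0..1}. h s \<in> loops Y y) \<and>
     continuous_map (top_of_set {0..1}) (compact_open_topology (top_of_set {0..1}) Y) h"
    by (auto simp: pathin_def loop_topology_def continuous_map_in_subtopology)
  also have "\<dots> \<longleftrightarrow> ?R"
  proof (rule conj_cong[OF refl])
    assume h: "\<forall>s\<in>{0..1}. h s \<in> loops Y y"
    let ?sub = "\<lambda>K U. {f \<in> extensional (topspace (top_of_set {0..1})).
      continuous_map (top_of_set {0..1}) Y f \<and> f ` K \<subseteq> U}"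
    have "continuous_map (top_of_set {0..1}) (compact_open_topology (top_of_set {0..1}) Y) h \<longleftrightarrow>
      (\<forall>K U. compactin (top_of_set {0..1}) K \<and> openin Y U \<longrightarrow>
        openin (top_of_set {0..1}) (h -` ?sub K U \<inter> topspace (top_of_set {0..1})))"
      using top[OF h]
      unfolding compact_open_topology_def continuous_on_generated_topo_iff
        topology_generated_by_topspace by blast
    then show "continuous_map (top_of_set {0..1}) (compact_open_topology (top_of_set {0..1}) Y) h \<longleftrightarrow>
      (\<forall>K U. compact K \<and> K \<subseteq> {0..1} \<and> openin Y U \<longrightarrow>
        openin (top_of_set {0..1}) {s\<in>{0..1}. h s ` K \<subseteq> U})"
      unfolding eq[OF h] comp by simp
  qed
  finally show ?thesis .
qed

section \<open>Concatenation of loops\<close>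

lemma const_loop_in_loops: "y \<in> topspace Y \<Longrightarrow> const_loop y \<in> loops Y y"
  unfolding loops_def const_loop_def pathin_def
  by (auto intro: continuous_map_eq[of _ _ "\<lambda>t. y"])

lemma concat_loops_in_loops:
  assumes "v \<in> loops Y y" "w \<in> loops Y y"
  shows "concat_loops v w \<in> loops Y y"
proof -
  have v: "continuous_map (top_of_set {0..1}) Y v" "v 0 = y" "v 1 = y"
    and w: "continuous_map (top_of_set {0..1}) Y w" "w 0 = y" "w 1 = y"
    using assms by (auto simp: loops_def pathin_def)
  have "continuous_map (top_of_set {0..1}) Y (\<lambda>t. if t \<le> 1/2 then v (2 * t) else w (2 * t - 1))"
  proof (rule continuous_map_cases_le)
    show "continuous_map (top_of_set {0..1}) euclideanreal (\<lambda>x. x)"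
      "continuous_map (top_of_set {0..1::real}) euclideanreal (\<lambda>x. 1/2)"
      by (auto simp: continuous_map_iff_continuous)
    show "continuous_map (subtopology (top_of_set {0..1}) {x \<in> topspace (top_of_set {0..1}). x \<le> 1/2})
        Y (\<lambda>t. v (2 * t))"
      by (rule continuous_map_compose[OF _ v(1), unfolded o_def])
        (auto simp: continuous_map_in_subtopology subtopology_subtopology
          intro!: continuous_intros)
    show "continuous_map (subtopology (top_of_set {0..1}) {x \<in> topspace (top_of_set {0..1}). 1/2 \<le> x})
        Y (\<lambda>t. w (2 * t - 1))"
      by (rule continuous_map_compose[OF _ w(1), unfolded o_def])
        (auto simp: continuous_map_in_subtopology subtopology_subtopology
          intro!: continuous_intros)
    show "v (2 * t) = w (2 * t - 1)" if "t = 1/2" for t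
      using v w that by (simp add: that)
  qed
  then have "continuous_map (top_of_set {0..1}) Y (concat_loops v w)"
    by (rule continuous_map_eq) (auto simp: concat_loops_def)
  then show ?thesis
    using v w by (auto simp: loops_def pathin_def concat_loops_def)
qed

lemma concat_loops_const: "concat_loops (const_loop y) (const_loop y) = const_loop y"
  by (auto simp: concat_loops_def const_loop_def fun_eq_iff)

lemma loops_eqI: "\<lbrakk>v \<in> loops Y y; w \<in> loops Y y; \<And>t. t \<in> {0..1} \<Longrightarrow> v t = w t\<rbrakk> \<Longrightarrow> v = w"
  by (auto simp: loops_def intro: extensionalityI)

text \<open>Each factor can be read off from its half of the interval. This rigidity is what leaves
  the other factor free in \<open>arc_move_concat\<close>.\<close>

lemma concat_loops_eq_iff:
  assumes "v \<in> loops Y y" "v' \<in> loops Y y" "w \<in> loops Y y" "w' \<in> loops Y y"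
  shows "concat_loops v w = concat_loops v' w' \<longleftrightarrow> v = v' \<and> w = w'"
proof
  assume eq: "concat_loops v w = concat_loops v' w'"
  have "v t = v' t" if "t \<in> {0..1}" for t
    using fun_cong[OF eq, of "t/2"] that by (simp add: concat_loops_def)
  \<comment> \<open>For \<open>t = 0\<close> the argument is \<open>1/2\<close>, which the
    definition assigns to the first factor; there \<open>w\<close> and \<open>w'\<close> agree as
    loops at \<open>y\<close>.\<close>
  moreover have "w t = w' t" if "t \<in> {0..1}" for t
    using fun_cong[OF eq, of "t/2 + 1/2"] that assms
    by (cases "t = 0") (auto simp: concat_loops_def loops_def)
  ultimately show "v = v' \<and> w = w'"
    using assms by (auto intro: loops_eqI)
qed auto

lemma concat_loops_eq_const_iff:
  assumes "v \<in> loops Y y" "w \<in> loops Y y"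
  shows "concat_loops v w = const_loop y \<longleftrightarrow> v = const_loop y \<and> w = const_loop y"
proof -
  have "y \<in> topspace Y"
    using assms(1) path_start_in_topspace[of Y v] by (simp add: loops_def)
  note C = const_loop_in_loops[OF this]
  show ?thesis
    using concat_loops_eq_iff[OF assms(1) C assms(2) C] by (simp add: concat_loops_const)
qed

text \<open>A concatenation maps \<open>K\<close> into \<open>U\<close> iff its first factor does so
  with the doubled left part of \<open>K\<close> and its second factor with the rescaled right part.
  Both conditions are open in \<open>s\<close>.\<close>

lemma pathin_concat_loops:
  assumes h: "pathin (loop_topology Y y) h" and k: "pathin (loop_topology Y y) k"
  shows "pathin (loop_topology Y y) (\<lambda>s. concat_loops (h s) (k s))"
  unfolding pathin_loop_topology_iff
proof (intro conjI ballI allI impI)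
  have hk: "h s \<in> loops Y y" "k s \<in> loops Y y" if "s \<in> {0..1}" for s
    using h k that by (auto simp: pathin_loop_topology_iff)
  show "concat_loops (h s) (k s) \<in> loops Y y" if "s \<in> {0..1}" for s
    using hk[OF that] by (rule concat_loops_in_loops)
  fix K :: "real set" and U assume K: "compact K \<and> K \<subseteq> {0..1} \<and> openin Y U"
  define K1 where "K1 = (\<lambda>t. 2 * t) ` (K \<inter> {0..1/2})"
  define K2 where "K2 = (\<lambda>t. 2 * t - 1) ` (K \<inter> {1/2..1})"
  have "compact K1" "compact K2" unfolding K1_def K2_def
    using K by (auto intro!: compact_continuous_image continuous_intros compact_Int)
  moreover have "K1 \<subseteq> {0..1}" "K2 \<subseteq> {0..1}" by (auto simp: K1_def K2_def)
  ultimately have "openin (top_of_set {0..1}) ({s\<in>{0..1}. h s ` K1 \<subseteq> U} \<inter> {s\<in>{0..1}. k s ` K2 \<subseteq> U})"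
    using h k K unfolding pathin_loop_topology_iff by (intro openin_Int) blast+
  also have "{s\<in>{0..1}. h s ` K1 \<subseteq> U} \<inter> {s\<in>{0..1}. k s ` K2 \<subseteq> U} =
      {s\<in>{0..1}. concat_loops (h s) (k s) ` K \<subseteq> U}"
  proof -
    have "h s ` K1 \<subseteq> U \<and> k s ` K2 \<subseteq> U \<longleftrightarrow> concat_loops (h s) (k s) ` K \<subseteq> U"
      if s: "s \<in> {0..1}" for s
    proof -
      \<comment> \<open>The time \<open>1/2\<close> lies in both parts of \<open>K\<close>, so the
        two branches must agree there.\<close>
      have *: "h s 1 = k s 0" using hk[OF s] by (simp add: loops_def)
      have 1: "concat_loops (h s) (k s) t = h s (2 * t)" if "t \<in> {0..1/2}" for t
        using that by (auto simp: concat_loops_def)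
      have 2: "concat_loops (h s) (k s) t = k s (2 * t - 1)" if "t \<in> {1/2..1}" for t
      proof (cases "t = 1/2")
        case True
        show ?thesis unfolding True using * by (simp add: concat_loops_def)
      qed (use that in \<open>auto simp: concat_loops_def\<close>)
      have "K = (K \<inter> {0..1/2}) \<union> (K \<inter> {1/2..1})" using K by auto
      then have "concat_loops (h s) (k s) ` K =
          concat_loops (h s) (k s) ` (K \<inter> {0..1/2}) \<union> concat_loops (h s) (k s) ` (K \<inter> {1/2..1})"
        by (metis image_Un)
      also have "\<dots> = h s ` K1 \<union> k s ` K2"
        unfolding K1_def K2_def image_image using 1 2 by (intro arg_cong2[of _ _ _ _ "(\<union>)"] image_cong) auto
      finally show ?thesis by auto
    qed
    then have "{s\<in>{0..1}. h s ` K1 \<subseteq> U \<and> k s ` K2 \<subseteq> U} =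
        {s\<in>{0..1}. concat_loops (h s) (k s) ` K \<subseteq> U}"
      by (intro Collect_cong conj_cong refl)
    then show ?thesis unfolding Collect_conj_eq by blast
  qed
  finally show "openin (top_of_set {0..1}) {s\<in>{0..1}. concat_loops (h s) (k s) ` K \<subseteq> U}" .
qed

section \<open>Reparametrisation of loops\<close>

definition reparam :: "(real \<Rightarrow> 'a) \<Rightarrow> (real \<Rightarrow> real) \<Rightarrow> real \<Rightarrow> 'a" where
  "reparam w \<phi> = (\<lambda>t\<in>{0..1}. w (\<phi> t))"

text \<open>Since \<open>w\<close> is at \<open>y\<close> at both ends, \<open>\<phi>\<close> may
  send an endpoint of the interval to either one; \<open>null_loop\<close> uses a
  \<open>\<phi>\<close> with both ends at \<open>0\<close>.\<close>

lemma reparam_in_loops: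
  assumes w: "w \<in> loops Y y" and \<phi>: "continuous_on {0..1} \<phi>" "\<phi> ` {0..1} \<subseteq> {0..1}"
    and ends: "\<phi> 0 \<in> {0,1}" "\<phi> 1 \<in> {0,1}"
  shows "reparam w \<phi> \<in> loops Y y"
proof -
  have "continuous_map (top_of_set {0..1}) (top_of_set {0..1}) \<phi>"
    using \<phi> by (auto simp: continuous_map_in_subtopology)
  then have "continuous_map (top_of_set {0..1}) Y (w \<circ> \<phi>)"
    by (rule continuous_map_compose) (use w in \<open>simp add: loops_def pathin_def\<close>)
  then have "continuous_map (top_of_set {0..1}) Y (reparam w \<phi>)"
    by (rule continuous_map_eq) (simp add: reparam_def)
  then show ?thesis
    using w ends by (auto simp: loops_def pathin_def reparam_def)
qed

text \<open>A tube lemma argument: the parameters \<open>s\<close> at which some \<open>t\<close> in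
  the compact \<open>K\<close> violates the condition form the projection of a compact set, hence a
  closed set.\<close>

lemma pathin_reparam:
  assumes w: "w \<in> loops Y y"
    and \<phi>: "continuous_on ({0..1} \<times> {0..1}) (\<lambda>(s,t). \<phi> s t)"
    and into: "\<And>s t. \<lbrakk>s \<in> {0..1}; t \<in> {0..1}\<rbrakk> \<Longrightarrow> \<phi> s t \<in> {0..1}"
    and ends: "\<And>s. s \<in> {0..1} \<Longrightarrow> \<phi> s 0 \<in> {0,1}" "\<And>s. s \<in> {0..1} \<Longrightarrow> \<phi> s 1 \<in> {0,1}"
  shows "pathin (loop_topology Y y) (\<lambda>s. reparam w (\<phi> s))"
  unfolding pathin_loop_topology_iff
proof (intro conjI ballI allI impI)
  show "reparam w (\<phi> s) \<in> loops Y y" if s: "s \<in> {0..1}" for s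
  proof (rule reparam_in_loops[OF w])
    have "continuous_on {0..1} ((\<lambda>(s,t). \<phi> s t) \<circ> (\<lambda>t. (s, t)))"
      by (rule continuous_on_compose)
        (use s in \<open>auto intro!: continuous_intros continuous_on_subset[OF \<phi>]\<close>)
    then show "continuous_on {0..1} (\<phi> s)" by (simp add: o_def)
  qed (use s into ends in auto)
  fix K :: "real set" and U assume K: "compact K \<and> K \<subseteq> {0..1} \<and> openin Y U"
  have "openin (top_of_set {0..1}) {t \<in> {0..1}. w t \<in> U}"
    using openin_continuous_map_preimage[of "top_of_set {0..1}" Y w U] w K
    by (simp add: loops_def pathin_def)
  then obtain V where V: "open V" "{t \<in> {0..1}. w t \<in> U} = {0..1} \<inter> V"
    by (auto simp: openin_open)
  \<comment> \<open>\<open>C\<close> collects the violating pairs \<open>(s, t)\<close>. As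
    \<open>\<phi>\<close> has values in \<open>{0..1}\<close>, membership of
    \<open>w (\<phi> s t)\<close> in \<open>U\<close> is membership of \<open>\<phi> s t\<close> in
    \<open>V\<close>.\<close>
  define C where "C = ({0..1} \<times> K) \<inter> (\<lambda>(s,t). \<phi> s t) -` (- V)"
  have "closed C"
    unfolding C_def
  proof (rule continuous_closed_preimage)
    show "continuous_on ({0..1} \<times> K) (\<lambda>(s,t). \<phi> s t)"
      by (rule continuous_on_subset[OF \<phi>]) (use K in auto)
    show "closed ({0..1::real} \<times> K)"
      using K by (simp add: closed_Times compact_imp_closed)
  qed (use V in auto)
  moreover have "compact ({0..1::real} \<times> K)"
    using K by (simp add: compact_Times)
  ultimately have "compact C"
    using compact_Int_closed[of "{0..1} \<times> K" C] by (simp add: C_def Int_absorb1)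
  then have "closed (fst ` C)"
    by (intro compact_imp_closed compact_continuous_image continuous_intros)
  moreover have "{s\<in>{0..1}. reparam w (\<phi> s) ` K \<subseteq> U} = {0..1} - fst ` C"
  proof -
    have "w (\<phi> s t) \<in> U \<longleftrightarrow> \<phi> s t \<in> V" if "s \<in> {0..1}" "t \<in> K" for s t
      using V(2) into[OF that(1), of t] that K by blast
    moreover have "reparam w (\<phi> s) t = w (\<phi> s t)" if "t \<in> K" for s t
      using that K by (auto simp: reparam_def)
    ultimately show ?thesis
      by (force simp: C_def image_subset_iff)
  qed
  ultimately show "openin (top_of_set {0..1}) {s\<in>{0..1}. reparam w (\<phi> s) ` K \<subseteq> U}"
    by (metis Diff_eq openin_open_Int open_Compl)
qed

section \<open>Squeezing a loop\<close>

text \<open>For \<open>l \<ge> 1\<close> the loop is traversed at speed \<open>l\<close>; the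
  \<open>min\<close> then makes it wait at its endpoint.\<close>

definition squeeze :: "real \<Rightarrow> (real \<Rightarrow> 'a) \<Rightarrow> real \<Rightarrow> 'a" where
  "squeeze l w = reparam w (\<lambda>t. min 1 (l * t))"

lemma squeeze_1: "w \<in> loops Y y \<Longrightarrow> squeeze 1 w = w"
  by (rule extensionalityI[of _ "{0..1}"]) (auto simp: squeeze_def reparam_def loops_def)

text \<open>At speed \<open>2\<close> the second half of the interval is spent waiting. This is how
  squeezing leads to concatenations with the constant loop.\<close>

lemma squeeze_2: "w \<in> loops Y y \<Longrightarrow> squeeze 2 w = concat_loops w (const_loop y)"
proof -
  assume w: "w \<in> loops Y y"
  have "w (min 1 (2 * t)) = (if t \<le> 1/2 then w (2 * t) else y)" for t
  proof (cases "t = 1/2")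
    case True
    show ?thesis unfolding True by simp
  qed (use w in \<open>auto simp: loops_def min_def\<close>)
  then show ?thesis
    by (auto simp: squeeze_def reparam_def concat_loops_def const_loop_def fun_eq_iff)
qed

lemma squeeze_squeeze:
  assumes "l \<ge> 1" "m \<ge> 1"
  shows "squeeze l (squeeze m w) = squeeze (l * m) w"
proof -
  have "min 1 (m * min 1 (l * t)) = min 1 (l * m * t)" if "t \<ge> 0" for t
  proof (cases "l * t \<le> 1")
    \<comment> \<open>If \<open>l * t > 1\<close>, both sides are \<open>1\<close> because
      \<open>m \<ge> 1\<close>.\<close>
    case False
    then have "m * 1 \<le> m * (l * t)" using assms by (intro mult_left_mono) auto
    then have "1 \<le> m * (l * t)" using False assms by linarith
    then have "1 \<le> l * m * t" by (simp only: mult_ac)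
    with False assms show ?thesis by simp
  qed (auto simp: mult_ac)
  then show ?thesis
    using assms by (auto simp: squeeze_def reparam_def fun_eq_iff)
qed

lemma pathin_squeeze:
  assumes "w \<in> loops Y y" "a \<ge> 1" "b \<ge> 1"
  shows "pathin (loop_topology Y y) (\<lambda>s. squeeze ((1 - s) * a + s * b) w)"
  unfolding squeeze_def
proof (rule pathin_reparam[OF assms(1)])
  \<comment> \<open>The interpolated speed never drops below \<open>1\<close>, so time
    \<open>1\<close> is always sent to \<open>1\<close>.\<close>
  have ge: "(1 - s) * a + s * b \<ge> 1" if "s \<in> {0..1}" for s
  proof -
    have "(1 - s) * 1 + s * 1 \<le> (1 - s) * a + s * b"
      using that assms by (intro add_mono mult_left_mono) auto
    then show ?thesis by simp
  qed
  show "min 1 (((1 - s) * a + s * b) * t) \<in> {0..1}" if "s \<in> {0..1}" "t \<in> {0..1}" for s t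
    using that ge[of s] by auto
  show "min 1 (((1 - s) * a + s * b) * 1) \<in> {0,1}" if "s \<in> {0..1}" for s
    using ge[OF that] by simp
qed (auto intro!: continuous_intros simp: case_prod_unfold)

lemma squeeze_in_loops: "\<lbrakk>w \<in> loops Y y; l \<ge> 1\<rbrakk> \<Longrightarrow> squeeze l w \<in> loops Y y"
  unfolding squeeze_def by (rule reparam_in_loops) (auto intro!: continuous_intros)

lemma path_component_squeeze:
  assumes "w \<in> loops Y y" "l \<ge> 1"
  shows "path_component_of (loop_topology Y y) w (squeeze l w)"
  unfolding path_component_of_def
  using pathin_squeeze[OF assms(1) _ assms(2), of 1] squeeze_1[OF assms(1)]
  by (intro exI[of _ "\<lambda>s. squeeze ((1 - s) * 1 + s * l) w"]) simp

text \<open>The supremum need not be attained. For the constant loop the set is empty and its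
  \<open>Sup\<close> carries no information, so the facts about \<open>last_time\<close> are stated
  for nonconstant loops.\<close>

definition last_time :: "'a \<Rightarrow> (real \<Rightarrow> 'a) \<Rightarrow> real" where
  "last_time y w = Sup {t \<in> {0..1}. w t \<noteq> y}"

lemma ne_const_loop:
  assumes "w \<in> loops Y y" "w \<noteq> const_loop y"
  obtains t where "0 < t" "t < 1" "w t \<noteq> y"
proof -
  have "\<exists>t\<in>{0..1}. w t \<noteq> y"
  proof (rule ccontr)
    assume "\<not> ?thesis"
    then have "w = const_loop y"
      using assms(1) by (intro extensionalityI[of _ "{0..1}"]) (auto simp: loops_def const_loop_def)
    with assms(2) show False ..
  qed
  then obtain t where t: "t \<in> {0..1}" "w t \<noteq> y" ..
  moreover have "t \<noteq> 0" "t \<noteq> 1" using t assms(1) by (auto simp: loops_def)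
  ultimately show ?thesis by (intro that[of t]) auto
qed

lemma last_time_pos:
  assumes "w \<in> loops Y y" "w \<noteq> const_loop y"
  shows "last_time y w > 0"
proof -
  obtain t where t: "0 < t" "t < 1" "w t \<noteq> y" using ne_const_loop[OF assms] .
  have "t \<le> last_time y w"
    unfolding last_time_def by (rule cSup_upper) (use t in \<open>auto intro: bdd_aboveI[of _ 1]\<close>)
  with t show ?thesis by simp
qed

text \<open>From time \<open>1 / l\<close> on the squeezed loop waits at \<open>y\<close>; before
  that it is \<open>w\<close> in shrunken time.\<close>

lemma squeeze_support:
  assumes "w \<in> loops Y y" "l \<ge> 1"
  shows "{t \<in> {0..1}. squeeze l w t \<noteq> y} = (\<lambda>t. t / l) ` {t \<in> {0..1}. w t \<noteq> y}"
proof (intro equalityI subsetI)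
  fix t assume t: "t \<in> {t \<in> {0..1}. squeeze l w t \<noteq> y}"
  then have "l * t < 1"
    using assms by (cases "l * t < 1") (auto simp: squeeze_def reparam_def loops_def)
  with t assms have "w (l * t) \<noteq> y" "l * t \<in> {0..1}"
    by (auto simp: squeeze_def reparam_def)
  then show "t \<in> (\<lambda>t. t / l) ` {t \<in> {0..1}. w t \<noteq> y}"
    using assms by (intro image_eqI[of _ _ "l * t"]) auto
next
  fix t assume "t \<in> (\<lambda>t. t / l) ` {t \<in> {0..1}. w t \<noteq> y}"
  then obtain r where r: "t = r / l" "r \<in> {0..1}" "w r \<noteq> y" by auto
  moreover have "r / l \<le> 1" using r assms by simp
  ultimately show "t \<in> {t \<in> {0..1}. squeeze l w t \<noteq> y}"
    using assms by (auto simp: squeeze_def reparam_def)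
qed

lemma last_time_squeeze:
  assumes "w \<in> loops Y y" "w \<noteq> const_loop y" "l \<ge> 1"
  shows "last_time y (squeeze l w) = last_time y w / l"
proof -
  let ?S = "{t \<in> {0..1}. w t \<noteq> y}"
  obtain t where "0 < t" "t < 1" "w t \<noteq> y" using ne_const_loop[OF assms(1,2)] .
  then have ne: "?S \<noteq> {}" by (auto intro!: exI[of _ t])
  have bdd: "bdd_above ?S" by (auto intro: bdd_aboveI[of _ 1])
  have "Sup ((\<lambda>t. t / l) ` ?S) = Sup ?S / l"
  \<comment> \<open>Division by \<open>l\<close> is monotone and continuous, hence commutes with the
    supremum of a nonempty bounded set.\<close>
  proof (rule continuous_at_Sup_mono[symmetric])
    show "mono (\<lambda>t. t / l)" using assms by (auto intro!: monoI divide_right_mono)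
    show "continuous (at_left (Sup ?S)) (\<lambda>t. t / l)"
      using assms by (intro continuous_intros) auto
  qed (use ne bdd in auto)
  then show ?thesis
    unfolding last_time_def squeeze_support[OF assms(1,3)] .
qed

lemma squeeze_ne_const:
  assumes "w \<in> loops Y y" "w \<noteq> const_loop y" "l \<ge> 1"
  shows "squeeze l w \<noteq> const_loop y"
proof -
  obtain t where "0 < t" "t < 1" "w t \<noteq> y" using ne_const_loop[OF assms(1,2)] .
  then have "t / l \<in> {t \<in> {0..1}. squeeze l w t \<noteq> y}"
    unfolding squeeze_support[OF assms(1,3)] by (intro imageI) simp
  then show ?thesis by (auto simp: const_loop_def)
qed

lemma squeeze_eq_imp_eq:
  assumes "u \<in> loops Y y" "v \<in> loops Y y" "l \<ge> 1" "squeeze l u = squeeze l v"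
  shows "u = v"
proof (rule loops_eqI[OF assms(1,2)])
  fix t :: real assume t: "t \<in> {0..1}"
  then have "t / l \<in> {0..1}" using assms by simp
  moreover have "l * (t / l) = t" using assms by simp
  ultimately show "u t = v t" using fun_cong[OF assms(4), of "t / l"] t
    by (simp add: squeeze_def reparam_def)
qed

text \<open>Squeezing divides the last time by the speed, and the last time is positive, so the
  speed can be recovered. Hence increasing the speed traces an arc of loops.\<close>

lemma squeeze_inj:
  assumes "w \<in> loops Y y" "w \<noteq> const_loop y" "l \<ge> 1" "m \<ge> 1" "squeeze l w = squeeze m w"
  shows "l = m"
proof -
  have "last_time y w / l = last_time y w / m"
    using last_time_squeeze[OF assms(1,2,3)] last_time_squeeze[OF assms(1,2,4)] assms(5) by metis
  then show ?thesis
    using last_time_pos[OF assms(1,2)] assms(3,4) by (simp add: frac_eq_eq)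
qed

section \<open>Moves along disjoint arcs of loops\<close>

text \<open>This spells out a formal homotopy from the pair of spheres: \<open>h\<close> and
  \<open>k\<close> are its restrictions to the lines over the two non-base points, and the constant
  loop is the image of the collapsed base line.\<close>

definition arc_move :: "'a topology \<Rightarrow> 'a \<Rightarrow> ((real \<Rightarrow> 'a) \<times> (real \<Rightarrow> 'a)) rel" where
  "arc_move Y y = {(p, q). \<exists>h k.
     pathin (loop_topology Y y) h \<and> pathin (loop_topology Y y) k \<and>
     p = (h 0, k 0) \<and> q = (h 1, k 1) \<and> inj_on h {0..1} \<and> inj_on k {0..1} \<and>
     (\<forall>s\<in>{0..1}. \<forall>s'\<in>{0..1}. h s \<noteq> k s') \<and>
     (\<forall>s\<in>{0..1}. h s \<noteq> const_loop y \<and> k s \<noteq> const_loop y)}"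

lemma arc_moveI:
  assumes "pathin (loop_topology Y y) h" "pathin (loop_topology Y y) k"
    "inj_on h {0..1}" "inj_on k {0..1}"
    "\<And>s s'. s \<in> {0..1} \<Longrightarrow> s' \<in> {0..1} \<Longrightarrow> h s \<noteq> k s'"
    "\<And>s. s \<in> {0..1} \<Longrightarrow> h s \<noteq> const_loop y" "\<And>s. s \<in> {0..1} \<Longrightarrow> k s \<noteq> const_loop y"
    "h 0 = u" "k 0 = v" "h 1 = u'" "k 1 = v'"
  shows "((u, v), (u', v')) \<in> arc_move Y y"
  unfolding arc_move_def mem_Collect_eq case_prod_conv
  using assms by (intro exI[of _ h] exI[of _ k]) auto

lemma arc_moveE:
  assumes "((u, v), (u', v')) \<in> arc_move Y y"
  obtains h k where "pathin (loop_topology Y y) h" "pathin (loop_topology Y y) k"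
    "inj_on h {0..1}" "inj_on k {0..1}"
    "\<And>s s'. s \<in> {0..1} \<Longrightarrow> s' \<in> {0..1} \<Longrightarrow> h s \<noteq> k s'"
    "\<And>s. s \<in> {0..1} \<Longrightarrow> h s \<noteq> const_loop y" "\<And>s. s \<in> {0..1} \<Longrightarrow> k s \<noteq> const_loop y"
    "h 0 = u" "k 0 = v" "h 1 = u'" "k 1 = v'"
proof -
  from assms obtain h k where "pathin (loop_topology Y y) h" "pathin (loop_topology Y y) k"
    "inj_on h {0..1}" "inj_on k {0..1}"
    "\<forall>s\<in>{0..1}. \<forall>s'\<in>{0..1}. h s \<noteq> k s'"
    "\<forall>s\<in>{0..1}. h s \<noteq> const_loop y \<and> k s \<noteq> const_loop y"
    "h 0 = u" "k 0 = v" "h 1 = u'" "k 1 = v'"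
    unfolding arc_move_def by auto
  then show ?thesis by (intro that[of h k]) auto
qed

lemma pathin_reverse:
  assumes "pathin X g" shows "pathin X (\<lambda>s. g (1 - s))"
proof -
  have "continuous_map (top_of_set {0..1}) (top_of_set {0..1::real}) (\<lambda>s. 1 - s)"
    by (auto simp: continuous_map_in_subtopology intro!: continuous_intros)
  from continuous_map_compose[OF this assms[unfolded pathin_def]]
  show ?thesis by (simp add: pathin_def o_def)
qed

lemma arc_move_sym:
  assumes "(p, q) \<in> arc_move Y y" shows "(q, p) \<in> arc_move Y y"
proof -
  obtain u v u' v' where pq: "p = (u, v)" "q = (u', v')" by fastforce
  obtain h k where hk: "pathin (loop_topology Y y) h" "pathin (loop_topology Y y) k"
    "inj_on h {0..1}" "inj_on k {0..1}"
    "\<And>s s'. s \<in> {0..1} \<Longrightarrow> s' \<in> {0..1} \<Longrightarrow> h s \<noteq> k s'"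
    "\<And>s. s \<in> {0..1} \<Longrightarrow> h s \<noteq> const_loop y" "\<And>s. s \<in> {0..1} \<Longrightarrow> k s \<noteq> const_loop y"
    "h 0 = u" "k 0 = v" "h 1 = u'" "k 1 = v'"
    using assms arc_moveE unfolding pq by metis
  have inj: "inj_on (\<lambda>s. f (1 - s)) {0..1}" if "inj_on f {0..1}" for f :: "real \<Rightarrow> real \<Rightarrow> 'a"
  proof (rule inj_onI)
    fix s s' :: real assume "s \<in> {0..1}" "s' \<in> {0..1}" "f (1 - s) = f (1 - s')"
    then show "s = s'" using inj_onD[OF that, of "1 - s" "1 - s'"] by auto
  qed
  show ?thesis unfolding pq
    by (rule arc_moveI[OF pathin_reverse[OF hk(1)] pathin_reverse[OF hk(2)]
          inj[OF hk(3)] inj[OF hk(4)]]) (use hk in auto)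
qed

text \<open>This symmetry allows the two loops to be ordered by their last times.\<close>

lemma arc_move_swap:
  assumes "((u, v), (u', v')) \<in> arc_move Y y" shows "((v, u), (v', u')) \<in> arc_move Y y"
proof -
  obtain h k where hk: "pathin (loop_topology Y y) h" "pathin (loop_topology Y y) k"
    "inj_on h {0..1}" "inj_on k {0..1}"
    "\<And>s s'. s \<in> {0..1} \<Longrightarrow> s' \<in> {0..1} \<Longrightarrow> h s \<noteq> k s'"
    "\<And>s. s \<in> {0..1} \<Longrightarrow> h s \<noteq> const_loop y" "\<And>s. s \<in> {0..1} \<Longrightarrow> k s \<noteq> const_loop y"
    "h 0 = u" "k 0 = v" "h 1 = u'" "k 1 = v'"
    using assms arc_moveE by metis
  show ?thesis
    by (rule arc_moveI[OF hk(2,1,4,3)]) (use hk(5)[symmetric] hk(6-) in auto)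
qed

lemma arc_move_rtrancl_sym:
  assumes "(p, q) \<in> (arc_move Y y)\<^sup>*" shows "(q, p) \<in> (arc_move Y y)\<^sup>*"
  by (rule symD[OF sym_rtrancl assms]) (auto intro: symI arc_move_sym)

lemma arc_move_rtrancl_swap:
  assumes "((u, v), (u', v')) \<in> (arc_move Y y)\<^sup>*"
  shows "((v, u), (v', u')) \<in> (arc_move Y y)\<^sup>*"
  using assms
proof (induction rule: rtrancl_induct2)
  case (step a b c d)
  then show ?case by (meson arc_move_swap rtrancl.rtrancl_into_rtrancl)
qed simp

lemma arc_move_path_component:
  assumes "((u, v), (u', v')) \<in> arc_move Y y"
  shows "path_component_of (loop_topology Y y) u u'" "path_component_of (loop_topology Y y) v v'"
  using assms unfolding path_component_of_def by (metis arc_moveE)+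

definition loop_config_set :: "'a topology \<Rightarrow> 'a \<Rightarrow> ((real \<Rightarrow> 'a) \<times> (real \<Rightarrow> 'a)) set" where
  "loop_config_set Y y =
     {(u, v). u \<in> loops Y y \<and> v \<in> loops Y y \<and> u \<noteq> const_loop y \<and> v \<noteq> const_loop y \<and> u \<noteq> v}"

lemma topspace_loop_config: "topspace (loop_config Y y) = loop_config_set Y y"
  by (auto simp: loop_config_def loop_config_set_def)

lemma arc_move_in_config:
  assumes "(p, q) \<in> arc_move Y y"
  shows "p \<in> loop_config_set Y y" "q \<in> loop_config_set Y y"
proof -
  have *: "p \<in> loop_config_set Y y" if pq: "(p, q) \<in> arc_move Y y" for p q
  proof -
    obtain u v u' v' where e: "p = (u, v)" "q = (u', v')" by fastforce
    obtain h k where hk: "pathin (loop_topology Y y) h" "pathin (loop_topology Y y) k"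
      "\<And>s s'. s \<in> {0..1} \<Longrightarrow> s' \<in> {0..1} \<Longrightarrow> h s \<noteq> k s'"
      "\<And>s. s \<in> {0..1} \<Longrightarrow> h s \<noteq> const_loop y" "\<And>s. s \<in> {0..1} \<Longrightarrow> k s \<noteq> const_loop y"
      "h 0 = u" "k 0 = v"
      using pq arc_moveE unfolding e by metis
    have "h 0 \<in> loops Y y" "k 0 \<in> loops Y y"
      using hk(1,2) unfolding pathin_loop_topology_iff by auto
    then show ?thesis
      using hk(3)[of 0 0] hk(4,5)[of 0] hk(6,7) by (auto simp: e loop_config_set_def)
  qed
  show "p \<in> loop_config_set Y y" "q \<in> loop_config_set Y y"
    using *[OF assms] *[OF arc_move_sym[OF assms]] .
qed

text \<open>Two concatenations agree only if both factors do. So injectivity, disjointness and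
  avoidance of the constant loop pass from \<open>h\<close> and \<open>k\<close> to the
  concatenations, while the paths from \<open>a\<close> to \<open>a'\<close> and from
  \<open>b\<close> to \<open>b'\<close> may cross each other or rest at the constant loop.\<close>

lemma arc_move_concat:
  assumes "((u, v), (u', v')) \<in> arc_move Y y"
    and a: "path_component_of (loop_topology Y y) a a'"
    and b: "path_component_of (loop_topology Y y) b b'"
  shows "((concat_loops u a, concat_loops v b), (concat_loops u' a', concat_loops v' b')) \<in> arc_move Y y"
    and "((concat_loops a u, concat_loops b v), (concat_loops a' u', concat_loops b' v')) \<in> arc_move Y y"
proof -
  obtain h k where hk: "pathin (loop_topology Y y) h" "pathin (loop_topology Y y) k"
    and inj: "inj_on h {0..1}" "inj_on k {0..1}"
    and ne: "\<And>s s'. s \<in> {0..1} \<Longrightarrow> s' \<in> {0..1} \<Longrightarrow> h s \<noteq> k s'"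
    "\<And>s. s \<in> {0..1} \<Longrightarrow> h s \<noteq> const_loop y" "\<And>s. s \<in> {0..1} \<Longrightarrow> k s \<noteq> const_loop y"
    and ends: "h 0 = u" "k 0 = v" "h 1 = u'" "k 1 = v'"
    using assms(1) arc_moveE by metis
  obtain f where f: "pathin (loop_topology Y y) f" "f 0 = a" "f 1 = a'"
    using a unfolding path_component_of_def by metis
  obtain g where g: "pathin (loop_topology Y y) g" "g 0 = b" "g 1 = b'"
    using b unfolding path_component_of_def by metis
  have L: "h s \<in> loops Y y" "k s \<in> loops Y y" "f s \<in> loops Y y" "g s \<in> loops Y y" if "s \<in> {0..1}" for s
    using hk f(1) g(1) that unfolding pathin_loop_topology_iff by auto
  note iff = concat_loops_eq_iff[where Y = Y and y = y]
    and c = concat_loops_eq_const_iff[where Y = Y and y = y]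
  show "((concat_loops u a, concat_loops v b), (concat_loops u' a', concat_loops v' b')) \<in> arc_move Y y"
    using pathin_concat_loops[OF hk(1) f(1)] pathin_concat_loops[OF hk(2) g(1)]
  proof (rule arc_moveI)
    show "inj_on (\<lambda>s. concat_loops (h s) (f s)) {0..1}"
      using inj(1) L iff by (simp add: inj_on_def)
    show "inj_on (\<lambda>s. concat_loops (k s) (g s)) {0..1}"
      using inj(2) L iff by (simp add: inj_on_def)
    show "concat_loops (h s) (f s) \<noteq> concat_loops (k s') (g s')" if "s \<in> {0..1}" "s' \<in> {0..1}" for s s'
      using ne(1)[OF that] L[OF that(1)] L[OF that(2)] iff by simp
    show "concat_loops (h s) (f s) \<noteq> const_loop y" "concat_loops (k s) (g s) \<noteq> const_loop y"
      if "s \<in> {0..1}" for s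
      using ne(2,3)[OF that] L[OF that] c by simp_all
  qed (simp_all add: ends f g)
  show "((concat_loops a u, concat_loops b v), (concat_loops a' u', concat_loops b' v')) \<in> arc_move Y y"
    using pathin_concat_loops[OF f(1) hk(1)] pathin_concat_loops[OF g(1) hk(2)]
  proof (rule arc_moveI)
    show "inj_on (\<lambda>s. concat_loops (f s) (h s)) {0..1}"
      using inj(1) L iff by (simp add: inj_on_def)
    show "inj_on (\<lambda>s. concat_loops (g s) (k s)) {0..1}"
      using inj(2) L iff by (simp add: inj_on_def)
    show "concat_loops (f s) (h s) \<noteq> concat_loops (g s') (k s')" if "s \<in> {0..1}" "s' \<in> {0..1}" for s s'
      using ne(1)[OF that] L[OF that(1)] L[OF that(2)] iff by simp
    show "concat_loops (f s) (h s) \<noteq> const_loop y" "concat_loops (g s) (k s) \<noteq> const_loop y"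
      if "s \<in> {0..1}" for s
      using ne(2,3)[OF that] L[OF that] c by simp_all
  qed (simp_all add: ends f g)
qed

section \<open>From configurations to concatenations with the constant loop\<close>

lemma arc_move_squeeze:
  assumes u: "u \<in> loops Y y" "u \<noteq> const_loop y" and v: "v \<in> loops Y y" "v \<noteq> const_loop y"
    and l: "1 \<le> l" "l < l'" and m: "1 \<le> m" "m < m'"
    and ne: "\<And>x z. \<lbrakk>x \<in> {l..l'}; z \<in> {m..m'}\<rbrakk> \<Longrightarrow> squeeze x u \<noteq> squeeze z v"
  shows "((squeeze l u, squeeze m v), (squeeze l' u, squeeze m' v)) \<in> arc_move Y y"
proof -
  \<comment> \<open>Interpolated speeds stay within the bounds for which \<open>ne\<close> gives
    disjointness.\<close>
  have mem: "(1 - s) * a + s * b \<in> {a..b}" if "a < b" "s \<in> {0..1}" for a b s :: real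
  proof -
    have "0 \<le> s * (b - a)" "0 \<le> (1 - s) * (b - a)" using that by simp_all
    then show ?thesis by (simp add: algebra_simps)
  qed
  \<comment> \<open>\<open>squeeze_inj\<close> leads from the loop back to its speed, and the speed
    is strictly increasing in \<open>s\<close>.\<close>
  have inj: "inj_on (\<lambda>s. squeeze ((1 - s) * a + s * b) w) {0..1}"
    if w: "w \<in> loops Y y" "w \<noteq> const_loop y" and ab: "1 \<le> a" "a < b" for a b w
  proof (rule inj_onI)
    fix s s' :: real
    assume s: "s \<in> {0..1}" "s' \<in> {0..1}"
      and eq: "squeeze ((1 - s) * a + s * b) w = squeeze ((1 - s') * a + s' * b) w"
    have "(1 - s) * a + s * b = (1 - s') * a + s' * b"
      using squeeze_inj[OF w _ _ eq] mem[OF ab(2) s(1)] mem[OF ab(2) s(2)] ab(1) by auto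
    then have "(s - s') * (b - a) = 0" by (simp add: algebra_simps)
    with ab show "s = s'" by simp
  qed
  show ?thesis
    using pathin_squeeze[OF u(1), of l l'] pathin_squeeze[OF v(1), of m m'] l m
  proof (intro arc_moveI[of Y y "\<lambda>s. squeeze ((1 - s) * l + s * l') u" "\<lambda>s. squeeze ((1 - s) * m + s * m') v"])
    show "squeeze ((1 - s) * l + s * l') u \<noteq> squeeze ((1 - s') * m + s' * m') v"
      if "s \<in> {0..1}" "s' \<in> {0..1}" for s s'
      using ne mem[OF l(2) that(1)] mem[OF m(2) that(2)] .
    show "squeeze ((1 - s) * l + s * l') u \<noteq> const_loop y" if "s \<in> {0..1}" for s
      using squeeze_ne_const[OF u] mem[OF l(2) that] l(1) by simp
    show "squeeze ((1 - s) * m + s * m') v \<noteq> const_loop y" if "s \<in> {0..1}" for s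
      using squeeze_ne_const[OF v] mem[OF m(2) that] m(1) by simp
  qed (use inj[OF u l] inj[OF v m] in simp_all)
qed

text \<open>The second conclusion offers an arc move of the first factors, during which the constant
  second factors can be exchanged for others; the last two say that its end lies in the path
  components of \<open>u\<close> and \<open>v\<close>. The witnesses are \<open>squeeze 2 u\<close>,
  \<open>v\<close>, \<open>squeeze 4 u\<close> and \<open>squeeze m v\<close>.\<close>

lemma arc_move_to_concat_const_aux:
  assumes "(u, v) \<in> loop_config_set Y y" "last_time y u \<le> last_time y v"
  shows "\<exists>u' v' u'' v''. ((u, v), (concat_loops u' (const_loop y), concat_loops v' (const_loop y))) \<in> (arc_move Y y)\<^sup>* \<and>
    ((u', v'), (u'', v'')) \<in> arc_move Y y \<and>
    path_component_of (loop_topology Y y) u u'' \<and> path_component_of (loop_topology Y y) v v''"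
proof -
  have u: "u \<in> loops Y y" "u \<noteq> const_loop y" and v: "v \<in> loops Y y" "v \<noteq> const_loop y" and uv: "u \<noteq> v"
    using assms by (auto simp: loop_config_set_def)
  define a b where "a = last_time y u" and "b = last_time y v"
  have ab: "0 < a" "a \<le> b"
    using assms(2) last_time_pos[OF u] by (auto simp: a_def b_def)
  \<comment> \<open>If \<open>squeeze x u = squeeze z v\<close>, then \<open>x / z = a / b\<close>. So \<open>v\<close> may move freely as long as its
    parameter stays below \<open>m\<close>, and both may move while that of \<open>u\<close> is the larger one.\<close>
  obtain m where m: "1 < m" "m < 2" "a < b \<Longrightarrow> a * m < b"
  proof (cases "a < b")
    case True
    then have "1 < min 2 (b / a)" using ab by simp
    then obtain m where "1 < m" "m < min 2 (b / a)" using dense by blast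
    then show ?thesis using that[of m] ab by (simp add: pos_less_divide_eq mult.commute)
  qed (use that[of "3/2"] in auto)
  have ne: "squeeze x u \<noteq> squeeze z v" if "1 \<le> x" "1 \<le> z" "z \<le> m \<or> z \<le> x" for x z
  proof
    assume eq: "squeeze x u = squeeze z v"
    have "a / x = b / z"
      using last_time_squeeze[OF u that(1)] last_time_squeeze[OF v that(2)] eq
      by (simp add: a_def b_def)
    then have *: "a * z = b * x" using that by (simp add: frac_eq_eq)
    show False
    proof (cases "a < b")
      case True
      from that(3) show False
      proof
        assume "z \<le> m"
        then have "a * z \<le> a * m" using ab by simp
        also have "\<dots> < b * 1" using m(3)[OF True] by simp
        also have "\<dots> \<le> b * x" using ab that by (intro mult_left_mono) auto
        finally show False using * by simp
      next
        assume "z \<le> x"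
        then have "a * z \<le> a * x" using ab by simp
        also have "\<dots> < b * x" using True that by simp
        finally show False using * by simp
      qed
    next
      \<comment> \<open>Here \<open>a = b\<close>, so the speeds coincide, and undoing the common
        squeeze would give \<open>u = v\<close>.\<close>
      case False
      then have "x = z" using * ab by simp
      then show False using squeeze_eq_imp_eq[OF u(1) v(1) that(1)] eq uv by simp
    qed
  qed
  \<comment> \<open>In moves 1 and 3 the speed of \<open>v\<close> stays between \<open>1\<close>
    and \<open>m\<close>; in move 2 it is at most \<open>2\<close> while that of \<open>u\<close> is
    at least \<open>2\<close>. So \<open>ne\<close> applies throughout.\<close>
  have 1: "((squeeze 1 u, squeeze 1 v), (squeeze 2 u, squeeze m v)) \<in> arc_move Y y"
    by (rule arc_move_squeeze[OF u v]) (use m ne in auto)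
  have 2: "((squeeze 2 u, squeeze m v), (squeeze 4 u, squeeze 2 v)) \<in> arc_move Y y"
    by (rule arc_move_squeeze[OF u v]) (use m ne in auto)
  have 3: "((squeeze 2 u, squeeze 1 v), (squeeze 4 u, squeeze m v)) \<in> arc_move Y y"
    by (rule arc_move_squeeze[OF u v]) (use m ne in auto)
  \<comment> \<open>The loop \<open>u\<close> must be at speed \<open>2\<close> before
    \<open>v\<close> passes \<open>m\<close>, and must keep moving while \<open>v\<close> goes on to
    speed \<open>2\<close>. Stopping at \<open>4 = 2 * 2\<close> makes the result again a
    concatenation with the constant loop.\<close>
  have 4: "squeeze 4 u = concat_loops (squeeze 2 u) (const_loop y)"
    using squeeze_2[OF squeeze_in_loops[OF u(1), of 2]] squeeze_squeeze[of 2 2 u] by simp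
  have "((u, v), (concat_loops (squeeze 2 u) (const_loop y), concat_loops v (const_loop y))) \<in> (arc_move Y y)\<^sup>*"
    using 1 2 unfolding 4 squeeze_1[OF u(1)] squeeze_1[OF v(1)] squeeze_2[OF v(1)] by (meson r_into_rtrancl rtrancl_trans)
  moreover have "((squeeze 2 u, v), (squeeze 4 u, squeeze m v)) \<in> arc_move Y y"
    using 3 squeeze_1[OF v(1)] by simp
  ultimately show ?thesis
    using path_component_squeeze[OF u(1), of 4] path_component_squeeze[OF v(1), of m] m by fastforce
qed

text \<open>One of the two loops has the smaller last time, up to equality, and arc moves are
  symmetric in the two loops.\<close>

lemma arc_move_to_concat_const:
  assumes "(u, v) \<in> loop_config_set Y y"
  obtains u' v' u'' v'' where
    "((u, v), (concat_loops u' (const_loop y), concat_loops v' (const_loop y))) \<in> (arc_move Y y)\<^sup>*"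
    "((u', v'), (u'', v'')) \<in> arc_move Y y"
    "path_component_of (loop_topology Y y) u u''" "path_component_of (loop_topology Y y) v v''"
proof (cases "last_time y u \<le> last_time y v")
  case True
  show ?thesis using arc_move_to_concat_const_aux[OF assms True] that by blast
next
  case False
  have "(v, u) \<in> loop_config_set Y y" using assms by (auto simp: loop_config_set_def)
  from arc_move_to_concat_const_aux[OF this] False obtain v' u' v'' u'' where
    "((v, u), (concat_loops v' (const_loop y), concat_loops u' (const_loop y))) \<in> (arc_move Y y)\<^sup>*"
    "((v', u'), (v'', u'')) \<in> arc_move Y y"
    "path_component_of (loop_topology Y y) u u''" "path_component_of (loop_topology Y y) v v''"
    by auto
  then show ?thesis using arc_move_rtrancl_swap arc_move_swap that by metis
qed

text \<open>Run along \<open>w\<close> up to time \<open>s\<close> and back, for \<open>s\<close> from \<open>0\<close> to \<open>1\<close>.\<close>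

lemma null_loop:
  assumes "w \<in> loops Y y" "w \<noteq> const_loop y"
  obtains n where "n \<in> loops Y y" "n \<noteq> const_loop y" "path_component_of (loop_topology Y y) (const_loop y) n"
proof -
  obtain t where t: "0 < t" "t < 1" "w t \<noteq> y" using ne_const_loop[OF assms] .
  define h where "h = (\<lambda>s. reparam w (\<lambda>t. s * (1 - \<bar>2 * t - 1\<bar>)))"
  have h: "pathin (loop_topology Y y) h"
    unfolding h_def
  proof (rule pathin_reparam[OF assms(1)])
    show "s * (1 - \<bar>2 * t - 1\<bar>) \<in> {0..1}" if "s \<in> {0..1}" "t \<in> {0..1}" for s t :: real
    proof -
      have "0 \<le> 1 - \<bar>2 * t - 1\<bar>" "1 - \<bar>2 * t - 1\<bar> \<le> 1" using that by auto
      then show ?thesis using that mult_le_one[of s "1 - \<bar>2 * t - 1\<bar>"] by simp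
    qed
  qed (auto intro!: continuous_intros simp: case_prod_unfold)
  moreover have "h 0 = const_loop y"
    using assms(1) by (auto simp: h_def reparam_def const_loop_def loops_def)
  \<comment> \<open>The tent function takes the value \<open>t\<close> at \<open>t / 2\<close>, so
    this loop passes through \<open>w t\<close>.\<close>
  moreover have "h 1 (t / 2) \<noteq> y"
    using t by (simp add: h_def reparam_def)
  then have "h 1 \<noteq> const_loop y" using t by (auto simp: const_loop_def)
  moreover have "h 1 \<in> loops Y y" using h by (simp add: pathin_loop_topology_iff)
  ultimately show ?thesis
    using that unfolding path_component_of_def by blast
qed

text \<open>Both configurations are brought to concatenations with second factors \<open>a\<close>,
  \<open>b\<close> and \<open>a'\<close>, \<open>b'\<close> respectively. The arc move between these
  second factors carries along the given homotopies of the first factors, which may meet each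
  other.\<close>

lemma path_components_imp_arc_moves:
  assumes F: "(u, v) \<in> loop_config_set Y y" "(u', v') \<in> loop_config_set Y y"
    and P: "path_component_of (loop_topology Y y) u u'" "path_component_of (loop_topology Y y) v v'"
  shows "((u, v), (u', v')) \<in> (arc_move Y y)\<^sup>*"
proof -
  let ?P = "path_component_of (loop_topology Y y)" and ?e = "const_loop y"
  note sym = path_component_of_sym and trans = path_component_of_trans
  have u: "u \<in> loops Y y" "u \<noteq> ?e" using F by (auto simp: loop_config_set_def)
  \<comment> \<open>The loops \<open>n\<close> and \<open>squeeze 2 n\<close> are distinct,
    nonconstant and both null-homotopic.\<close>
  obtain n where n: "n \<in> loops Y y" "n \<noteq> ?e" "?P ?e n" using null_loop[OF u] .
  have "squeeze 2 n \<noteq> n"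
    using squeeze_inj[OF n(1,2), of 2 1] squeeze_1[OF n(1)] by auto
  then have "(n, squeeze 2 n) \<in> loop_config_set Y y"
    using n squeeze_in_loops[OF n(1), of 2] squeeze_ne_const[OF n(1,2), of 2]
    by (auto simp: loop_config_set_def)
  \<comment> \<open>What is taken from \<open>arc_move_to_concat_const\<close> here is the arc move
    that it supplies. All four of its ends are null-homotopic.\<close>
  then obtain a b a' b' where ab: "((a, b), (a', b')) \<in> arc_move Y y" "?P n a'" "?P (squeeze 2 n) b'"
    by (rule arc_move_to_concat_const)
  have "?P ?e a'" using trans[OF n(3) ab(2)] .
  moreover have "?P ?e b'"
    using trans[OF trans[OF n(3) path_component_squeeze[OF n(1), of 2]] ab(3)] by simp
  ultimately have null: "?P ?e a" "?P ?e b" "?P ?e a'" "?P ?e b'"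
    using arc_move_path_component[OF ab(1)] sym trans by metis+
  obtain u1 v1 u2 v2 where 1:
    "((u, v), (concat_loops u1 ?e, concat_loops v1 ?e)) \<in> (arc_move Y y)\<^sup>*"
    "((u1, v1), (u2, v2)) \<in> arc_move Y y" "?P u u2" "?P v v2"
    using arc_move_to_concat_const[OF F(1)] .
  obtain u1' v1' u2' v2' where 2:
    "((u', v'), (concat_loops u1' ?e, concat_loops v1' ?e)) \<in> (arc_move Y y)\<^sup>*"
    "((u1', v1'), (u2', v2')) \<in> arc_move Y y" "?P u' u2'" "?P v' v2'"
    using arc_move_to_concat_const[OF F(2)] .
  \<comment> \<open>While the first factors run along disjoint arcs to \<open>u2\<close> and
    \<open>v2\<close>, the constant second factors are deformed to \<open>a\<close> and
    \<open>b\<close>.\<close>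
  have "((u, v), (concat_loops u2 a, concat_loops v2 b)) \<in> (arc_move Y y)\<^sup>*"
    using 1(1) arc_move_concat(1)[OF 1(2) null(1,2)] by (rule rtrancl.rtrancl_into_rtrancl)
  \<comment> \<open>Now the second factors supply the arcs, and the first follow arbitrary paths,
    which exist through the components of \<open>u\<close>, \<open>u'\<close> and of
    \<open>v\<close>, \<open>v'\<close>.\<close>
  moreover have "((concat_loops u2 a, concat_loops v2 b), (concat_loops u2' a', concat_loops v2' b')) \<in> arc_move Y y"
    by (rule arc_move_concat(2)[OF ab(1)]) (use 1 2 P sym trans in metis)+
  \<comment> \<open>The same replacement starting from the other configuration; this chain is then
    run backwards.\<close>
  moreover have "((u', v'), (concat_loops u2' a', concat_loops v2' b')) \<in> (arc_move Y y)\<^sup>*"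
    using 2(1) arc_move_concat(1)[OF 2(2) null(3,4)] by (rule rtrancl.rtrancl_into_rtrancl)
  ultimately show ?thesis
    by (meson arc_move_rtrancl_sym rtrancl.rtrancl_into_rtrancl rtrancl_trans)
qed

section \<open>Morphisms from the pair of spheres\<close>

abbreviation self_loops :: "'a topology \<Rightarrow> 'a \<Rightarrow> (real \<Rightarrow> 'a) based_ispace" where
  "self_loops Y y \<equiv> loop_ispace 2 (self_ispace Y y)"

definition pair_of_morphism :: "(nat \<Rightarrow> nat \<Rightarrow> 'b) \<Rightarrow> 'b \<times> 'b" where
  "pair_of_morphism f = (f 1 1, f 2 2)"

definition morphism_of_pair :: "'a \<Rightarrow> (real \<Rightarrow> 'a) \<times> (real \<Rightarrow> 'a) \<Rightarrow> nat \<Rightarrow> nat \<Rightarrow> real \<Rightarrow> 'a" where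
  "morphism_of_pair y p = (\<lambda>i\<in>{1, 2}. \<lambda>x\<in>{0, i}.
     if x = 0 then const_loop y else if i = 1 then fst p else snd p)"

lemma atLeastAtMost_1_2: "{1..2} = {1, 2::nat}"
  by auto

lemma self_loops_simps:
  "pc (self_loops Y y) i = loops Y y" "bp (self_loops Y y) i = const_loop y"
  "subtopology (amb (self_loops Y y)) (loops Y y) = loop_topology Y y"
  by (auto simp: loop_ispace_def self_ispace_def loop_topology_def subtopology_subtopology)

lemma sphere0_pair_simps:
  "pc sphere0_pair i = {0, i}" "bp sphere0_pair i = 0"
  "i \<in> {1, 2} \<Longrightarrow> subtopology (amb sphere0_pair) {0, i} = discrete_topology {0, i}"
proof -
  assume i: "i \<in> {1, 2}"
  have "{0, 1, 2} \<inter> {0, i} = {0, i}" using i by auto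
  then show "subtopology (amb sphere0_pair) {0, i} = discrete_topology {0, i}"
    by (simp add: sphere0_pair_def)
qed (simp_all add: sphere0_pair_def)

text \<open>The spheres are discrete, so continuity is automatic.\<close>

lemma based_morphisms_iff:
  "f \<in> based_morphisms 2 sphere0_pair (self_loops Y y) \<longleftrightarrow>
     f \<in> (\<Pi>\<^sub>E i\<in>{1, 2}. {0, i} \<rightarrow>\<^sub>E loops Y y) \<and>
     (\<forall>i\<in>{1, 2}. \<forall>j\<in>{1, 2}. \<forall>x\<in>{0, i}. \<forall>x'\<in>{0, j}. f i x = f j x' \<longleftrightarrow> x = x') \<and>
     (\<forall>i\<in>{1, 2}. f i 0 = const_loop y)"
proof -
  have cont: "\<forall>i\<in>{1, 2}. continuous_map (subtopology (amb sphere0_pair) {0, i}) (loop_topology Y y) (f i)"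
    if "f \<in> (\<Pi>\<^sub>E i\<in>{1, 2}. {0, i} \<rightarrow>\<^sub>E loops Y y)"
  proof
    fix i :: nat assume i: "i \<in> {1, 2}"
    show "continuous_map (subtopology (amb sphere0_pair) {0, i}) (loop_topology Y y) (f i)"
      using PiE_mem[OF that i] unfolding sphere0_pair_simps(3)[OF i]
      by (auto simp: PiE_iff)
  qed
  show ?thesis
    unfolding based_morphisms_def ispace_morphisms_def mem_Collect_eq self_loops_simps
      sphere0_pair_simps(1,2) atLeastAtMost_1_2
    by (rule iffI; elim conjE; intro conjI; (assumption | rule cont))
qed

text \<open>Both base points are \<open>0\<close>, so the base lines of the two cylinders count as
  one common point.\<close>

lemma based_formal_homotopy_iff:
  "based_formal_homotopy 2 sphere0_pair (self_loops Y y) H \<longleftrightarrow>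
     (\<forall>i\<in>{1, 2}.
        continuous_map (prod_topology (discrete_topology {0, i}) (top_of_set {0..1})) (loop_topology Y y) (H i) \<and>
        (\<forall>t\<in>{0..1}. H i (0, t) = const_loop y)) \<and>
     (\<forall>i\<in>{1, 2}. \<forall>j\<in>{1, 2}. \<forall>p\<in>{0, i} \<times> {0..1}. \<forall>q\<in>{0, j} \<times> {0..1}.
        H i p = H j q \<longleftrightarrow> p = q \<or> fst p = 0 \<and> fst q = 0)"
  unfolding based_formal_homotopy_def cyl_eq_def self_loops_simps
    sphere0_pair_simps(1,2) atLeastAtMost_1_2
  by (intro conj_cong ball_cong refl) (simp_all only: sphere0_pair_simps(3) simp_thms)

text \<open>Injectivity keeps the values at \<open>1\<close> and \<open>2\<close> apart from each
  other and from the constant loop at \<open>0\<close>. All remaining values are prescribed, by the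
  base point condition or by extensionality.\<close>

lemma based_morphismsD:
  assumes "f \<in> based_morphisms 2 sphere0_pair (self_loops Y y)"
  shows "pair_of_morphism f \<in> loop_config_set Y y"
    and "f = morphism_of_pair y (pair_of_morphism f)"
proof -
  note * = assms[unfolded based_morphisms_iff]
  note f = *[THEN conjunct1]
    and inj = *[THEN conjunct2, THEN conjunct1, THEN bspec, THEN bspec, THEN bspec, THEN bspec]
    and base = *[THEN conjunct2, THEN conjunct2, THEN bspec]
  have fi: "f i \<in> {0, i} \<rightarrow>\<^sub>E loops Y y" if "i \<in> {1, 2}" for i
    using f that by (rule PiE_mem)
  have L: "f i i \<in> loops Y y" if "i \<in> {1, 2}" for i
    using fi[OF that] by (rule PiE_mem) simp
  have ne: "f i i \<noteq> const_loop y" if "i \<in> {1, 2}" for i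
    using inj[OF that that, of i 0] base[OF that] that by auto
  show "pair_of_morphism f \<in> loop_config_set Y y"
    using L[of 1] L[of 2] ne[of 1] ne[of 2] inj[of 1 2 1 2]
    by (simp add: pair_of_morphism_def loop_config_set_def)
  have "f i x = morphism_of_pair y (pair_of_morphism f) i x" for i x
  proof (cases "i \<in> {1, 2}")
    case True
    then have "f i x = undefined" if "x \<notin> {0, i}"
      using fi[OF True] that by (intro PiE_arb)
    with True base[OF True] show ?thesis
      by (auto simp: morphism_of_pair_def pair_of_morphism_def)
  next
    case False
    then have "f i = undefined" using f by (intro PiE_arb)
    with False show ?thesis by (simp add: morphism_of_pair_def)
  qed
  then show "f = morphism_of_pair y (pair_of_morphism f)" by blast
qed

lemma pair_of_morphism_of_pair [simp]: "pair_of_morphism (morphism_of_pair y p) = p"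
  by (simp add: pair_of_morphism_def morphism_of_pair_def)

lemma morphism_of_pair_in_based_morphisms:
  assumes y: "y \<in> topspace Y" and p: "p \<in> loop_config_set Y y"
  shows "morphism_of_pair y p \<in> based_morphisms 2 sphere0_pair (self_loops Y y)"
proof -
  let ?f = "morphism_of_pair y p"
  obtain u v where uv: "p = (u, v)" "u \<in> loops Y y" "v \<in> loops Y y" "u \<noteq> const_loop y"
    "v \<noteq> const_loop y" "u \<noteq> v"
    using p by (auto simp: loop_config_set_def)
  show ?thesis
    unfolding based_morphisms_iff
  proof (intro conjI ballI)
    show "?f \<in> (\<Pi>\<^sub>E i\<in>{1, 2}. {0, i} \<rightarrow>\<^sub>E loops Y y)"
    proof (rule PiE_I)
      show "?f i \<in> {0, i} \<rightarrow>\<^sub>E loops Y y" if "i \<in> {1, 2}" for i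
        using that const_loop_in_loops[OF y] uv by (auto simp: morphism_of_pair_def)
    qed (simp add: morphism_of_pair_def)
    show "?f i x = ?f j x' \<longleftrightarrow> x = x'"
      if "i \<in> {1, 2}" "j \<in> {1, 2}" "x \<in> {0, i}" "x' \<in> {0, j}" for i j x x'
      using that uv(2-) by (auto simp: morphism_of_pair_def uv(1))
    show "?f i 0 = const_loop y" if "i \<in> {1, 2}" for i
      using that by (auto simp: morphism_of_pair_def)
  qed
qed

section \<open>Formal homotopies and paths of configurations\<close>

lemma continuous_map_prod_discrete:
  assumes "\<And>a. a \<in> A \<Longrightarrow> continuous_map X Y (\<lambda>x. g (a, x))"
  shows "continuous_map (prod_topology (discrete_topology A) X) Y g"
  unfolding continuous_map_def
proof (intro conjI allI impI)
  show "g \<in> topspace (prod_topology (discrete_topology A) X) \<rightarrow> topspace Y"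
    using continuous_map_funspace[OF assms] by (auto simp: Pi_iff)
  fix U assume U: "openin Y U"
  \<comment> \<open>The product is the disjoint union of its slices, each of them open.\<close>
  have "{p \<in> topspace (prod_topology (discrete_topology A) X). g p \<in> U} =
      (\<Union>a\<in>A. {a} \<times> {x \<in> topspace X. g (a, x) \<in> U})"
    by auto
  also have "openin (prod_topology (discrete_topology A) X) \<dots>"
    using openin_continuous_map_preimage[OF assms U]
    by (intro openin_Union) (auto simp: openin_prod_Times_iff)
  finally show "openin (prod_topology (discrete_topology A) X)
      {p \<in> topspace (prod_topology (discrete_topology A) X). g p \<in> U}" .
qed

text \<open>Comparing the homotopy with itself at equal times shows that the pair of loops over the
  non-base points stays in the configuration space.\<close>

lemma formally_homotopic_imp_path_component:
  assumes "(f, g) \<in> formally_homotopic 2 sphere0_pair (self_loops Y y)"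
  shows "path_component_of (loop_config Y y) (pair_of_morphism f) (pair_of_morphism g)"
proof -
  obtain H where H: "based_formal_homotopy 2 sphere0_pair (self_loops Y y) H"
    and ends: "\<And>i x. i \<in> {1, 2} \<Longrightarrow> x \<in> {0, i} \<Longrightarrow> H i (x, 0) = f i x \<and> H i (x, 1) = g i x"
    using assms unfolding formally_homotopic_def sphere0_pair_simps(1) atLeastAtMost_1_2 by blast
  note * = H[unfolded based_formal_homotopy_iff]
  note cont = *[THEN conjunct1, THEN bspec, THEN conjunct1]
    and base = *[THEN conjunct1, THEN bspec, THEN conjunct2, THEN bspec]
    and iff = *[THEN conjunct2, THEN bspec, THEN bspec, THEN bspec, THEN bspec]
  have path: "pathin (loop_topology Y y) (\<lambda>t. H i (i, t))" if "i \<in> {1, 2}" for i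
    unfolding pathin_def
    by (rule continuous_map_compose[OF _ cont[OF that], unfolded o_def])
      (auto simp: continuous_map_pairwise o_def)
  have "H 1 (1, t) \<noteq> H 2 (2, t)" "const_loop y \<noteq> H 1 (1, t)" "const_loop y \<noteq> H 2 (2, t)"
    if "t \<in> {0..1}" for t
    using iff[of 1 2 "(1, t)" "(2, t)"] iff[of 1 1 "(1, t)" "(0, t)"] iff[of 2 2 "(2, t)" "(0, t)"]
      base[of 1 t] base[of 2 t] that by auto
  then have "pathin (loop_config Y y) (\<lambda>t. (H 1 (1, t), H 2 (2, t)))"
    using path[of 1] path[of 2]
    by (auto simp: loop_config_def pathin_def continuous_map_in_subtopology continuous_map_pairwise o_def)
  moreover have "pair_of_morphism f = (H 1 (1, 0), H 2 (2, 0))" "pair_of_morphism g = (H 1 (1, 1), H 2 (2, 1))"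
    using ends[of 1 1] ends[of 2 2] by (auto simp: pair_of_morphism_def)
  ultimately show ?thesis
    unfolding path_component_of_def by force
qed

text \<open>The two arcs, together with the constant loop on the base lines, form a homotopy; the
  conditions of \<open>arc_move\<close> are its injectivity on the collapsed cylinders.\<close>

lemma arc_move_imp_formally_homotopic:
  assumes y: "y \<in> topspace Y" and pq: "(p, q) \<in> arc_move Y y"
  shows "(morphism_of_pair y p, morphism_of_pair y q) \<in> formally_homotopic 2 sphere0_pair (self_loops Y y)"
proof -
  obtain u v u' v' where e: "p = (u, v)" "q = (u', v')" by fastforce
  obtain h k where hk: "pathin (loop_topology Y y) h" "pathin (loop_topology Y y) k"
    "inj_on h {0..1}" "inj_on k {0..1}"
    "\<And>s s'. s \<in> {0..1} \<Longrightarrow> s' \<in> {0..1} \<Longrightarrow> h s \<noteq> k s'"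
    "\<And>s. s \<in> {0..1} \<Longrightarrow> h s \<noteq> const_loop y" "\<And>s. s \<in> {0..1} \<Longrightarrow> k s \<noteq> const_loop y"
    "h 0 = u" "k 0 = v" "h 1 = u'" "k 1 = v'"
    using pq arc_moveE unfolding e by metis
  define H where "H = (\<lambda>i::nat. \<lambda>(x::nat, t). if x = 0 then const_loop y else if i = 1 then h t else k t)"
  have H: "H i (0, t) = const_loop y" "H 1 (1, t) = h t" "H 2 (2, t) = k t" for i t
    by (auto simp: H_def)
  have cont: "continuous_map (prod_topology (discrete_topology {0, i}) (top_of_set {0..1})) (loop_topology Y y) (H i)"
    if "i \<in> {1, 2}" for i
  proof (rule continuous_map_prod_discrete)
    fix x
    have "(\<lambda>t. H i (x, t)) = (if x = 0 then \<lambda>t. const_loop y else if i = 1 then h else k)"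
      by (auto simp: H_def)
    then show "continuous_map (top_of_set {0..1}) (loop_topology Y y) (\<lambda>t. H i (x, t))"
      using hk(1,2) const_loop_in_loops[OF y] by (auto simp: pathin_def)
  qed
  have iff: "H i (x, t) = H j (x', t') \<longleftrightarrow> x = x' \<and> t = t' \<or> x = 0 \<and> x' = 0"
    if "i \<in> {1, 2}" "j \<in> {1, 2}" "x \<in> {0, i}" "x' \<in> {0, j}" "t \<in> {0..1}" "t' \<in> {0..1}"
    for i j x x' t t'
    using that hk(5)[of t t'] hk(5)[of t' t] hk(6,7)[of t] hk(6,7)[of t']
      inj_on_eq_iff[OF hk(3), of t t'] inj_on_eq_iff[OF hk(4), of t t']
    by (auto simp: H_def split: if_splits)
  have "based_formal_homotopy 2 sphere0_pair (self_loops Y y) H"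
    unfolding based_formal_homotopy_iff
  proof (intro conjI ballI)
    fix i j :: nat and a b :: "nat \<times> real"
    assume "i \<in> {1, 2}" "j \<in> {1, 2}" "a \<in> {0, i} \<times> {0..1}" "b \<in> {0, j} \<times> {0..1}"
    then show "H i a = H j b \<longleftrightarrow> a = b \<or> fst a = 0 \<and> fst b = 0"
      using iff[of i j "fst a" "fst b" "snd a" "snd b"] by (simp add: mem_Times_iff prod_eq_iff)
  qed (use cont H(1) in simp_all)
  moreover have "H i (x, 0) = morphism_of_pair y p i x \<and> H i (x, 1) = morphism_of_pair y q i x"
    if "i \<in> {1, 2}" "x \<in> {0, i}" for i x
    using that hk(8-) by (auto simp: H_def morphism_of_pair_def e)
  ultimately show ?thesis
    using morphism_of_pair_in_based_morphisms[OF y] arc_move_in_config[OF pq]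
    unfolding formally_homotopic_def sphere0_pair_simps(1) atLeastAtMost_1_2 by blast
qed

text \<open>A chain of formal homotopies yields a composite path. Conversely a path is replaced by a
  chain of arc moves, each of which is a formal homotopy.\<close>

lemma homotopic_rel_iff_path_component:
  assumes y: "y \<in> topspace Y"
    and f: "f \<in> based_morphisms 2 sphere0_pair (self_loops Y y)"
    and g: "g \<in> based_morphisms 2 sphere0_pair (self_loops Y y)"
  shows "(f, g) \<in> homotopic_rel 2 sphere0_pair (self_loops Y y) \<longleftrightarrow>
    path_component_of (loop_config Y y) (pair_of_morphism f) (pair_of_morphism g)" (is "?L \<longleftrightarrow> ?R")
proof
  let ?S = "formally_homotopic 2 sphere0_pair (self_loops Y y)"
  assume ?L
  then have "(f, g) \<in> (?S \<union> ?S\<inverse>)\<^sup>*" by (simp add: homotopic_rel_def)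
  then show ?R
  proof (induction rule: rtrancl_induct)
    case base
    show ?case using based_morphismsD(1)[OF f] by (simp add: path_component_of_refl topspace_loop_config)
  next
    case (step g g')
    from step(2) have "path_component_of (loop_config Y y) (pair_of_morphism g) (pair_of_morphism g')"
      by (elim UnE converseE)
        (auto intro: formally_homotopic_imp_path_component
          path_component_of_sym[OF formally_homotopic_imp_path_component])
    with step(3) show ?case by (rule path_component_of_trans)
  qed
next
  let ?S = "formally_homotopic 2 sphere0_pair (self_loops Y y)"
  assume R: ?R
  obtain u v u' v' where e: "pair_of_morphism f = (u, v)" "pair_of_morphism g = (u', v')" by fastforce
  obtain c where c: "pathin (loop_config Y y) c" "c 0 = (u, v)" "c 1 = (u', v')"
    using R unfolding path_component_of_def e by blast
  \<comment> \<open>The path is split into two separate homotopies of loops, which is all that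
    \<open>path_components_imp_arc_moves\<close> asks for besides the configurations at the
    ends.\<close>
  have "pathin (loop_topology Y y) (fst \<circ> c)" "pathin (loop_topology Y y) (snd \<circ> c)"
    using c(1) by (auto simp: pathin_def loop_config_def continuous_map_in_subtopology continuous_map_pairwise)
  then have "path_component_of (loop_topology Y y) u u'" "path_component_of (loop_topology Y y) v v'"
    unfolding path_component_of_def using c(2,3)
    by - (rule exI[of _ "fst \<circ> c"], simp, rule exI[of _ "snd \<circ> c"], simp)
  then have "((u, v), (u', v')) \<in> (arc_move Y y)\<^sup>*"
    using based_morphismsD(1)[OF f] based_morphismsD(1)[OF g]
    unfolding e by (intro path_components_imp_arc_moves)
  then have "(morphism_of_pair y (u, v), morphism_of_pair y (u', v')) \<in> ?S\<^sup>*"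
  proof (induction rule: rtrancl_induct)
    case (step p q)
    from step(3) arc_move_imp_formally_homotopic[OF y step(2)] show ?case
      by (rule rtrancl.rtrancl_into_rtrancl)
  qed simp
  then have "(f, g) \<in> ?S\<^sup>*"
    using based_morphismsD(2)[OF f] based_morphismsD(2)[OF g] unfolding e by simp
  then have "(f, g) \<in> (?S \<union> ?S\<inverse>)\<^sup>*"
    by (rule rtrancl_mono[THEN subsetD, rotated]) auto
  then show ?L using f g by (simp add: homotopic_rel_def)
qed

section \<open>The bijection on classes and its multiplicativity\<close>

lemma pair_of_morphism_homotopy_class:
  assumes y: "y \<in> topspace Y"
    and f: "f \<in> based_morphisms 2 sphere0_pair (self_loops Y y)"
  shows "pair_of_morphism ` (homotopic_rel 2 sphere0_pair (self_loops Y y) `` {f}) =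
    path_component_of_set (loop_config Y y) (pair_of_morphism f)" (is "?e ` (?R `` {f}) = ?C")
proof (intro equalityI subsetI)
  fix p assume "p \<in> ?e ` (?R `` {f})"
  then obtain g where g: "(f, g) \<in> ?R" "p = ?e g" by auto
  moreover have "g \<in> based_morphisms 2 sphere0_pair (self_loops Y y)"
    using g(1) by (auto simp: homotopic_rel_def)
  ultimately show "p \<in> ?C"
    using homotopic_rel_iff_path_component[OF y f] by simp
next
  fix p assume p: "p \<in> ?C"
  then have "p \<in> loop_config_set Y y"
    using path_component_of_equiv[of "loop_config Y y" "?e f" p] by (simp add: topspace_loop_config)
  note g = morphism_of_pair_in_based_morphisms[OF y this]
  have "(f, morphism_of_pair y p) \<in> ?R"
    using homotopic_rel_iff_path_component[OF y f g] p by simp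
  then show "p \<in> ?e ` (?R `` {f})"
    by (intro image_eqI[of _ _ "morphism_of_pair y p"]) auto
qed

text \<open>Distinctness survives concatenation because the factors can be recovered.\<close>

lemma concat_pairs_in_config:
  assumes "p \<in> loop_config_set Y y" "q \<in> loop_config_set Y y"
  shows "concat_pairs p q \<in> loop_config_set Y y"
proof -
  obtain u v u' v' where "p = (u, v)" "q = (u', v')" by fastforce
  with assms show ?thesis
    by (simp add: loop_config_set_def concat_pairs_def concat_loops_in_loops
        concat_loops_eq_const_iff[of _ Y] concat_loops_eq_iff[of _ Y y])
qed

text \<open>At the base point the constant loop is concatenated with itself, which gives the
  constant loop again.\<close>

lemma concat_morphisms_eq:
  "concat_morphisms (morphism_of_pair y p) (morphism_of_pair y q) = morphism_of_pair y (concat_pairs p q)"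
  unfolding concat_morphisms_def morphism_of_pair_def concat_pairs_def sphere0_pair_simps(1) atLeastAtMost_1_2
  by (intro restrict_ext) (simp add: concat_loops_const)

theorem theorem2p4:
  fixes Y :: "'a topology" and y0 :: 'a
  assumes "y0 \<in> topspace Y"
  shows "\<exists>\<phi>. mult_iso
           (pi0_loop_ispace (loop_ispace 2 (self_ispace Y y0)))
           (pi0_loop_mult (loop_ispace 2 (self_ispace Y y0)))
           (path_components_of (loop_config Y y0))
           (pi0_config_mult Y y0)
           \<phi>"
proof -
  let ?M = "based_morphisms 2 sphere0_pair (self_loops Y y0)"
  let ?R = "homotopic_rel 2 sphere0_pair (self_loops Y y0)"
  \<comment> \<open>The isomorphism sends a homotopy class to its image under
    \<open>?e\<close>.\<close>
  let ?e = "pair_of_morphism :: _ \<Rightarrow> (real \<Rightarrow> 'a) \<times> (real \<Rightarrow> 'a)"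
  let ?Q = "pi0_loop_ispace (self_loops Y y0)"
  note cls = pair_of_morphism_homotopy_class[OF assms]
  have Q: "?Q = (\<lambda>f. ?R `` {f}) ` ?M"
    by (auto simp: pi0_loop_ispace_def homotopy_classes_def quotient_def)
  have sub: "A \<subseteq> ?M" if "A \<in> ?Q" for A
    using that unfolding Q by (auto simp: homotopic_rel_def)
  have inj: "inj_on ?e ?M"
    by (rule inj_onI) (metis based_morphismsD(2))
  have surj: "?e ` ?M = loop_config_set Y y0"
  proof (intro equalityI subsetI)
    fix p assume "p \<in> loop_config_set Y y0"
    then show "p \<in> ?e ` ?M"
      by (intro image_eqI[of _ _ "morphism_of_pair y0 p"] morphism_of_pair_in_based_morphisms assms) simp_all
  qed (use based_morphismsD(1) in auto)
  \<comment> \<open>As \<open>?e\<close> is injective on morphisms, a class is determined by its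
    image.\<close>
  have "inj_on ((`) ?e) ?Q"
    by (rule inj_onI) (metis inj sub inj_on_image_eq_iff)
  moreover have "(`) ?e ` ?Q = path_components_of (loop_config Y y0)"
    unfolding Q path_components_of_def topspace_loop_config surj[symmetric] image_image
    by (rule image_cong) (use cls in auto)
  \<comment> \<open>Both products are unions over all pairs of representatives, so they are compared
    pair by pair.\<close>
  moreover have "?e ` pi0_loop_mult (self_loops Y y0) A B = pi0_config_mult Y y0 (?e ` A) (?e ` B)"
    if "A \<in> ?Q" "B \<in> ?Q" for A B
  proof -
    have "?e ` (?R `` {concat_morphisms f g}) =
        path_component_of_set (loop_config Y y0) (concat_pairs (?e f) (?e g))"
      if "f \<in> A" "g \<in> B" for f g
    proof -
      have fg: "f \<in> ?M" "g \<in> ?M" using that sub \<open>A \<in> ?Q\<close> \<open>B \<in> ?Q\<close> by auto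
      have "concat_morphisms f g = morphism_of_pair y0 (concat_pairs (?e f) (?e g))"
        using concat_morphisms_eq[of y0 "?e f" "?e g"] fg based_morphismsD(2) by metis
      moreover have "morphism_of_pair y0 (concat_pairs (?e f) (?e g)) \<in> ?M"
        by (intro morphism_of_pair_in_based_morphisms assms concat_pairs_in_config
            based_morphismsD(1) fg)
      ultimately show ?thesis using cls by simp
    qed
    then show ?thesis
      unfolding pi0_loop_mult_def pi0_config_mult_def by (simp add: image_UN)
  qed
  ultimately have "mult_iso ?Q (pi0_loop_mult (self_loops Y y0))
      (path_components_of (loop_config Y y0)) (pi0_config_mult Y y0) ((`) ?e)"
    unfolding mult_iso_def bij_betw_def by (intro conjI ballI)
  then show ?thesis by (rule exI[of _ "(`) ?e"])
qed

end
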